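(* Let $p$ be a prime, $n,m\ge1$, $q,q_1,\dots,q_m,r_1,\dots,r_m\in[1,\infty)$, $\alpha,\alpha_1,\dots,\alpha_m$ with $\alpha_i\in(-n,\infty)$, $\beta_1,\dots,\beta_m\in\mathbb R$, $\ell,\ell_1,\dots,\ell_m\in[1,\infty)$ satisfy $$\sum_{i=1}^m\frac1{q_i}+\sum_{i=1}^m\frac1{r_i}=\frac1q,\quad \sum_{i=1}^m\frac{\alpha_i}{q_i}+\sum_{i=1}^m\frac{\alpha_i}{r_i}=\frac{\alpha}{q},\quad \sum_{i=1}^m\frac1{\ell_i}=\frac1\ell.$$ Let $\omega_i(x)=|x|_p^{\alpha_i}$, $b_i\in\dot{CMO}^{r_i}_{\omega_i}(\mathbb Q_p^n)$, $\lambda_i\ge0$ for $i=1,\dots,m$, $\omega(x)=|x|_p^\alpha$, $\Omega\in L^{q'}(S_0)$, $\lambda^*=\lambda_1+\cdots+\lambda_m$, $$\beta^*=\beta_1+\cdots+\beta_m-\frac{n+\alpha_1}{r_1}-\cdots-\frac{n+\alpha_m}{r_m},$$ and assume $$\mathcal C_8=\sum_{\gamma\in\mathbb Z}\frac{\Phi(p^\gamma)}{p^{\gamma(1-\beta^*-\frac{n+\alpha}{q}+\lambda^* )}}\prod_{i=1}^m\big(2+p^{|\gamma|(\alpha_i+n)}\big)<\infty.$$ Then for all $f_i\in MK^{\beta_i,\lambda_i}_{\ell_i,q_i,\omega_i}(\mathbb Q_p^n)$, $$\|\mathcal H^p_{\Phi,\Omega,\vec b}(\vec f)\|_{MK^{\beta^*,\lambda^*}_{\ell,q,\omega}(\mathbb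 Q_p^n)}\lesssim\mathcal C_8\,\|\Omega\|_{L^{q'}(S_0)}\prod_{i=1}^m\|b_i\|_{\dot{CMO}^{r_i}_{\omega_i}(\mathbb Q_p^n)}\prod_{i=1}^m\|f_i\|_{MK^{\beta_i,\lambda_i}_{\ell_i,q_i,\omega_i}(\mathbb Q_p^n)}.$$
   Context: $\mathbb Q_p$ is the field of $p$-adic numbers with norm $|\cdot|_p$; on $\mathbb Q_p^n$, $|x|_p=\max_j|x_j|_p$. $B_k=\{|x|_p\le p^k\}$, $S_k=\{|x|_p=p^k\}$, $\chi_k$ is the characteristic function of $S_k$, $dx$ is Haar measure with $|B_0|=1$. $\Phi:\mathbb Q_p\to[0,\infty)$, $\Omega:S_0\to\mathbb C$ measurable, $\Omega\ne0$ a.e.; $q'$ is the conjugate exponent. The commutator is $$\mathcal H^p_{\Phi,\Omega,\vec b}(\vec f)(x)=\sum_{\gamma\in\mathbb Z}\int_{S_0}\frac{\Phi(p^\gamma)}{p^\gamma}\Omega(y)\prod_{i=1}^m\big(b_i(x)-b_i(p^\gamma|x|_p^{-1}y)\big)\prod_{i=1}^mf_i(p^\gamma|x|_p^{-1}y)\,dy.$$ For a weight $w$, $w(E)=\int_Ew$ and $L^s_w$ has norm $(\int|f|^sw)^{1/s}$. $MK^{b,\mu}_{l,s,w}(\mathbb Q_p^n)$ ($\mu\ge0$) consists of $f\in L^s_{w,\mathrm{loc}}(\mathbb Q_p^n\setminus\{0\})$ with $\|f\|=\sup_{k_0\in\mathbb Z}p^{-k_0\mu}\big(\sum_{k\le k_0}p^{kbl}\|f\chi_k\|^l_{L^s_w}\big)^{1/l}<\infty$.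 $\dot{CMO}^r_w(\mathbb Q_p^n)$ consists of $f\in L^r_{w,\mathrm{loc}}$ with $\|f\|=\sup_{\gamma\in\mathbb Z}\big(\frac1{w(B_\gamma)}\int_{B_\gamma}|f-f_{w,B_\gamma}|^rw\big)^{1/r}<\infty$, $f_{w,B_\gamma}=\frac1{w(B_\gamma)}\int_{B_\gamma}fw$. $A\lesssim B$ means $A\le CB$ with $C$ independent of $\Phi,\Omega,\vec b,\vec f$. *)

theory Defs
  imports "HOL-Probability.Probability"
begin

text \<open>A p-adic number x = sum_k a_k p^k is represented by its digit function
  a :: int => nat (digits in {0..p-1}, only finitely many nonzero digits at negative
  indices). A point of Q_p^n is a function from a finite index type 'n (n = CARD('n))
  to such digit functions.\<close>

type_synonym qp = "int \<Rightarrow> nat"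
type_synonym 'n qpn = "'n \<Rightarrow> qp"

definition Qp_carrier :: "nat \<Rightarrow> qp set" where
  "Qp_carrier p = {a. (\<forall>k. a k < p) \<and> (\<exists>N. \<forall>k<N. a k = 0)}"

definition Qpn_carrier :: "nat \<Rightarrow> 'n qpn set" where
  "Qpn_carrier p = {x. \<forall>i. x i \<in> Qp_carrier p}"

definition qp_val :: "qp \<Rightarrow> int" where
  "qp_val a = (LEAST k. a k \<noteq> 0)"

definition qp_norm :: "nat \<Rightarrow> qp \<Rightarrow> real" where
  "qp_norm p a = (if (\<forall>k. a k = 0) then 0 else real p powr (- real_of_int (qp_val a)))"

definition qpn_norm :: "nat \<Rightarrow> ('n::finite) qpn \<Rightarrow> real" where
  "qpn_norm p x = Max (range (\<lambda>i. qp_norm p (x i)))"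

definition qp_ppow :: "int \<Rightarrow> qp" where
  "qp_ppow j = (\<lambda>k. if k = j then 1 else 0)"

definition qpn_ppow_scale :: "int \<Rightarrow> 'n qpn \<Rightarrow> 'n qpn" where
  "qpn_ppow_scale j y = (\<lambda>i k. y i (k - j))"

text \<open>The integer k with |x|_p = p^k (for x \<noteq> 0).\<close>
definition qpn_normexp :: "nat \<Rightarrow> ('n::finite) qpn \<Rightarrow> int" where
  "qpn_normexp p x = (THE k::int. qpn_norm p x = real p powr real_of_int k)"

definition ballp :: "nat \<Rightarrow> int \<Rightarrow> ('n::finite) qpn set" where
  "ballp p k = {x \<in> Qpn_carrier p. qpn_norm p x \<le> real p powr real_of_int k}"

definition sphp :: "nat \<Rightarrow> int \<Rightarrow> ('n::finite) qpn set" where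
  "sphp p k = {x \<in> Qpn_carrier p. qpn_norm p x = real p powr real_of_int k}"

text \<open>Borel sigma-algebra of Q_p^n (product sigma algebra on digits).\<close>
definition qpn_space :: "('n qpn) measure" where
  "qpn_space = Pi\<^sub>M UNIV (\<lambda>_. Pi\<^sub>M UNIV (\<lambda>_. count_space UNIV))"

text \<open>Digit expansion map [0,oo) -> Q_p, inverse (up to null sets) of the Monna map
  sum_k a_k p^k |-> sum_k a_k p^(-k-1), which carries Haar measure to Lebesgue measure.\<close>
definition padic_digits :: "nat \<Rightarrow> real \<Rightarrow> qp" where
  "padic_digits p t = (\<lambda>k. nat (\<lfloor>t * real p powr (real_of_int k + 1)\<rfloor> mod int p))"

text \<open>Haar measure on Q_p^n, normalised by |B_0| = 1.\<close>
definition haar :: "nat \<Rightarrow> ('n::finite qpn) measure" where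
  "haar p = distr (Pi\<^sub>M UNIV (\<lambda>_::'n. restrict_space lborel {0::real..})) qpn_space
               (\<lambda>t i. padic_digits p (t i))"

text \<open>Real powers of extended nonnegative reals (used only with positive exponents).\<close>
definition epowr :: "ennreal \<Rightarrow> real \<Rightarrow> ennreal" where
  "epowr x r = (if x = \<top> then \<top> else ennreal (enn2real x powr r))"

definition wLnorm :: "nat \<Rightarrow> real \<Rightarrow> (('n::finite) qpn \<Rightarrow> real) \<Rightarrow> 'n qpn set
    \<Rightarrow> ('n qpn \<Rightarrow> complex) \<Rightarrow> ennreal" where
  "wLnorm p s w E f = epowr (\<integral>\<^sup>+ x\<in>E. ennreal (norm (f x) powr s * w x) \<partial>haar p) (1 / s)"

definition MK_norm :: "nat \<Rightarrow> real \<Rightarrow> real \<Rightarrow> real \<Rightarrow> real \<Rightarrow> (('n::finite) qpn \<Rightarrow> real)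
    \<Rightarrow> ('n qpn \<Rightarrow> complex) \<Rightarrow> ennreal" where
  "MK_norm p b \<mu> l s w f =
     (SUP k0::int. ennreal (real p powr (- real_of_int k0 * \<mu>)) *
        epowr (\<Sum>\<^sub>\<infinity> k\<in>{..k0}. ennreal (real p powr (real_of_int k * b * l)) *
                 epowr (wLnorm p s w (sphp p k) f) l) (1 / l))"

text \<open>f \<in> MK^{b,mu}_{l,s,w}: measurable, in L^s_{w,loc}(Q_p^n \ {0}) (i.e. the weighted
  L^s integral over every sphere S_k is finite; every compact subset of Q_p^n\{0} is
  covered by finitely many S_k), and of finite norm.\<close>
definition MK_space :: "nat \<Rightarrow> real \<Rightarrow> real \<Rightarrow> real \<Rightarrow> real \<Rightarrow> (('n::finite) qpn \<Rightarrow> real)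
    \<Rightarrow> ('n qpn \<Rightarrow> complex) set" where
  "MK_space p b \<mu> l s w = {f. f \<in> borel_measurable (haar p) \<and>
      (\<forall>k. (\<integral>\<^sup>+ x\<in>sphp p k. ennreal (norm (f x) powr s * w x) \<partial>haar p) < \<top>) \<and>
      MK_norm p b \<mu> l s w f < \<top>}"

definition wmeas :: "nat \<Rightarrow> (('n::finite) qpn \<Rightarrow> real) \<Rightarrow> 'n qpn set \<Rightarrow> ennreal" where
  "wmeas p w E = (\<integral>\<^sup>+ x\<in>E. ennreal (w x) \<partial>haar p)"

definition wavg :: "nat \<Rightarrow> (('n::finite) qpn \<Rightarrow> real) \<Rightarrow> 'n qpn set \<Rightarrow> ('n qpn \<Rightarrow> complex)
    \<Rightarrow> complex" where
  "wavg p w E f = complex_of_real (1 / enn2real (wmeas p w E)) *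
      (LINT x:E|haar p. complex_of_real (w x) * f x)"

definition CMO_norm :: "nat \<Rightarrow> real \<Rightarrow> (('n::finite) qpn \<Rightarrow> real) \<Rightarrow> ('n qpn \<Rightarrow> complex)
    \<Rightarrow> ennreal" where
  "CMO_norm p r w f = (SUP g::int.
      epowr ((\<integral>\<^sup>+ x\<in>ballp p g. ennreal (norm (f x - wavg p w (ballp p g) f) powr r * w x) \<partial>haar p)
             / wmeas p w (ballp p g)) (1 / r))"

definition CMO_space :: "nat \<Rightarrow> real \<Rightarrow> (('n::finite) qpn \<Rightarrow> real) \<Rightarrow> ('n qpn \<Rightarrow> complex) set" where
  "CMO_space p r w = {f. f \<in> borel_measurable (haar p) \<and>
      (\<forall>g. (\<integral>\<^sup>+ x\<in>ballp p g. ennreal (norm (f x) powr r * w x) \<partial>haar p) < \<top>) \<and>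
      CMO_norm p r w f < \<top>}"

definition Lconj_norm_S0 :: "nat \<Rightarrow> real \<Rightarrow> (('n::finite) qpn \<Rightarrow> complex) \<Rightarrow> ennreal" where
  "Lconj_norm_S0 p q \<Omega> =
     (if q = 1 then Inf {c::ennreal. AE y in haar p. y \<in> sphp p 0 \<longrightarrow> ennreal (norm (\<Omega> y)) \<le> c}
      else epowr (\<integral>\<^sup>+ y\<in>sphp p 0. ennreal (norm (\<Omega> y) powr (q / (q - 1))) \<partial>haar p) ((q - 1) / q))"

definition Hcomm :: "nat \<Rightarrow> (qp \<Rightarrow> real) \<Rightarrow> (('n::finite) qpn \<Rightarrow> complex) \<Rightarrow> nat
    \<Rightarrow> (nat \<Rightarrow> 'n qpn \<Rightarrow> complex) \<Rightarrow> (nat \<Rightarrow> 'n qpn \<Rightarrow> complex) \<Rightarrow> 'n qpn \<Rightarrow> complex" where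
  "Hcomm p \<Phi> \<Omega> m b f x =
     (\<Sum>\<^sub>\<infinity> \<gamma>::int. LINT y:sphp p 0|haar p.
        complex_of_real (\<Phi> (qp_ppow \<gamma>) / real p powr real_of_int \<gamma>) * \<Omega> y *
        (\<Prod>i\<in>{1..m}. b i x - b i (qpn_ppow_scale (\<gamma> - qpn_normexp p x) y)) *
        (\<Prod>i\<in>{1..m}. f i (qpn_ppow_scale (\<gamma> - qpn_normexp p x) y)))"

end

theory Submission
  imports Defs
begin

text \<open>On the sphere \<open>S\<^sub>k\<close> the \<open>\<gamma>\<close>-th term of the commutator only involves the values of \<open>f\<^sub>i\<close> on
  \<open>S\<^bsub>k-\<gamma>\<^esub>\<close>. Hoelder's inequality, first in \<open>y\<close> against \<open>\<Omega>\<close> and then on \<open>S\<^sub>k \<times> S\<^sub>0\<close> with exponents \<open>r\<^sub>i, q\<^sub>i\<close>,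
  reduces its weighted \<open>L\<^sup>q\<close> norm to the norms of the single factors. For \<open>b\<^sub>i(x) - b\<^sub>i(z)\<close> one inserts the
  averages of \<open>b\<^sub>i\<close> over \<open>B\<^sub>k\<close> and \<open>B\<^bsub>k-\<gamma>\<^esub>\<close>: the two oscillations contribute \<open>2\<close> and the difference of the
  averages \<open>p\<^bsup>|\<gamma>|(\<alpha>\<^sub>i+n)\<^esup>\<close>, the ratio of the weighted volumes of the two balls. The powers of \<open>p\<^sup>k\<close> then
  cancel, and Minkowski's inequality in \<open>\<gamma>\<close> with Hoelder's inequality in \<open>k\<close> leaves exactly the series \<open>C8\<close>.
  Everything is carried out with extended nonnegative integrals, so that no integrability of
  the commutator itself is required: divergent integrals and sums are \<open>0\<close> by convention.\<close>

subsection \<open>Hoelder's and Minkowski's inequalities\<close>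

text \<open>The factors b_i(x) - b_i(z) involve both variables, so Hoelder in y alone cannot
  separate them. Keeping the exponent q for both x and y makes the iterated norm a single L^q norm
  on the product, where all 2m factors split under the one condition that the reciprocals of the q_i
  and r_i add up to 1/q.

  A power weight is constant on a sphere and costs only a power of p there. Its singularity at the
  origin matters only for averages over balls; this is where \<alpha>_i > -n is used.

  The main fact about Haar measure is its behaviour under y -> p^j y. On digits this is an index
  shift, and the expansion map turns it into the dilation of [0,oo)^n by p^(-j), so the Jacobian is
  that of Lebesgue measure.

  The value of \<open>\<beta>s\<close> is forced by requiring that k occur only through the factors
  p^(k \<beta>_i). The power of p^\<gamma> in \<open>C8\<close> then comes from the identity: sum of
  (n + \<alpha>_i)/q_i plus sum of \<beta>_i equals \<open>\<beta>s\<close> + (n +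
  \<alpha>)/q.\<close>

lemma epowr_top [simp]: "epowr \<top> r = \<top>"
  by (simp add: epowr_def)

lemma epowr_0 [simp]: "epowr 0 r = 0"
  by (simp add: epowr_def)

lemma epowr_ennreal: "0 \<le> x \<Longrightarrow> epowr (ennreal x) r = ennreal (x powr r)"
  by (simp add: epowr_def)

lemma epowr_one [simp]: "epowr 1 r = 1"
  using epowr_ennreal[of 1 r] by simp

lemma epowr_exponent_1 [simp]: "epowr x 1 = x"
  by (cases x) (auto simp: epowr_ennreal)

lemma epowr_eq_0_iff [simp]: "epowr x r = 0 \<longleftrightarrow> x = 0"
  by (cases x) (auto simp: epowr_ennreal)

lemma epowr_eq_top_iff [simp]: "epowr x r = \<top> \<longleftrightarrow> x = \<top>"
  by (cases x) (auto simp: epowr_ennreal)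

lemma epowr_mult:
  assumes "r > 0"
  shows "epowr (x * y) r = epowr x r * epowr y r"
proof (cases "x = \<top> \<or> y = \<top>")
  case True
  then show ?thesis by (auto simp: ennreal_mult_eq_top_iff ennreal_top_mult ennreal_mult_top)
next
  case False
  then obtain a b where "x = ennreal a" "y = ennreal b" "a \<ge> 0" "b \<ge> 0"
    by (metis ennreal_cases)
  then show ?thesis
    by (simp add: epowr_ennreal powr_mult flip: ennreal_mult)
qed

lemma epowr_mono:
  assumes "r \<ge> 0" "x \<le> y"
  shows "epowr x r \<le> epowr y r"
proof (cases "y = \<top>")
  case False
  then obtain b where "y = ennreal b" "b \<ge> 0" by (metis ennreal_cases)
  moreover from this obtain a where "x = ennreal a" "a \<ge> 0"
    using assms by (metis ennreal_cases ennreal_neq_top top.extremum_unique)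
  ultimately show ?thesis
    using assms by (simp add: epowr_ennreal powr_mono2)
qed simp

lemma epowr_epowr: "epowr (epowr x r) s = epowr x (r * s)"
  by (cases x) (auto simp: epowr_ennreal powr_powr)

text \<open>Powers of 0 are 0 and powers of \<top> are \<top> whatever the sign of the exponent,
  which makes this unconditional. The price is that the zeroth power of 0 or \<top> is not
  1.\<close>

lemma epowr_add: "epowr x (s + t) = epowr x s * epowr x t"
  by (cases x) (auto simp: epowr_ennreal powr_add ennreal_mult ennreal_top_mult)

lemma epowr_prod:
  assumes "r > 0"
  shows "epowr (\<Prod>i\<in>I. f i) r = (\<Prod>i\<in>I. epowr (f i) r)"
  by (induction I rule: infinite_finite_induct) (auto simp: epowr_mult[OF assms])

lemma epowr_le_iff:
  assumes "r > 0"
  shows "epowr x r \<le> y \<longleftrightarrow> x \<le> epowr y (1 / r)"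
  using epowr_mono[of "1 / r" "epowr x r" y] epowr_mono[of r x "epowr y (1 / r)"] assms
  by (auto simp: epowr_epowr)

lemma measurable_epowr [measurable]:
  assumes [measurable]: "f \<in> borel_measurable M"
  shows "(\<lambda>x. epowr (f x) r) \<in> borel_measurable M"
  unfolding epowr_def by measurable

section \<open>Weighted means and Hoelder's inequality\<close>

lemma ennreal_prod_eq_top:
  fixes f :: "'i \<Rightarrow> ennreal"
  assumes "finite I" "i \<in> I" "f i = \<top>" "\<And>j. j \<in> I \<Longrightarrow> f j \<noteq> 0"
  shows "(\<Prod>j\<in>I. f j) = \<top>"
proof -
  have "(\<Prod>j\<in>I. f j) = f i * (\<Prod>j\<in>I-{i}. f j)"
    using assms by (simp add: prod.remove)
  moreover have "(\<Prod>j\<in>I-{i}. f j) \<noteq> 0"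
    using assms by (auto simp: prod_zero_iff)
  ultimately show ?thesis using assms by (simp add: ennreal_top_mult)
qed

text \<open>Jensen's inequality for the convex function \<open>exp\<close> at the points
  \<open>ln (x i)\<close>.\<close>

lemma weighted_arith_geom_mean:
  fixes x :: "'i \<Rightarrow> real"
  assumes "finite I" "\<And>i. i \<in> I \<Longrightarrow> x i > 0" "\<And>i. i \<in> I \<Longrightarrow> \<theta> i \<ge> 0" "sum \<theta> I = 1"
  shows "(\<Prod>i\<in>I. x i powr \<theta> i) \<le> (\<Sum>i\<in>I. \<theta> i * x i)"
proof -
  have "(\<Prod>i\<in>I. x i powr \<theta> i) = exp (\<Sum>i\<in>I. \<theta> i * ln (x i))"
    using assms by (auto simp: exp_sum powr_def less_imp_neq[THEN not_sym] dest: assms(2) intro!: prod.cong)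
  also have "\<dots> \<le> (\<Sum>i\<in>I. \<theta> i * exp (ln (x i)))"
    using convex_on_sum[OF \<open>finite I\<close> _ exp_convex assms(4) assms(3), of "\<lambda>i. ln (x i)"] assms(4)
    by (cases "I = {}") auto
  also have "\<dots> = (\<Sum>i\<in>I. \<theta> i * x i)"
    using assms by (intro sum.cong) auto
  finally show ?thesis .
qed

text \<open>A value 0 annihilates the left side even next to \<top>, and a value \<top> makes the
  right side infinite because its weight is positive. Otherwise the logarithms exist and the real
  inequality applies.\<close>

lemma weighted_arith_geom_mean_ennreal:
  assumes "finite I" "\<And>i. i \<in> I \<Longrightarrow> \<theta> i > 0" "sum \<theta> I = 1"
  shows "(\<Prod>i\<in>I. epowr (x i) (\<theta> i)) \<le> (\<Sum>i\<in>I. ennreal (\<theta> i) * x i)"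
proof (cases "(\<exists>i\<in>I. x i = 0) \<or> (\<exists>i\<in>I. x i = \<top>)")
  case True
  then consider i where "i \<in> I" "x i = 0" | i where "i \<in> I" "x i = \<top>" by blast
  then show ?thesis
  proof cases
    case 1
    then have "(\<Prod>i\<in>I. epowr (x i) (\<theta> i)) = 0"
      by (intro prod_zero assms(1)) auto
    then show ?thesis by (metis zero_le)
  next
    case 2
    have "ennreal (\<theta> i) * x i = \<top>"
      using assms(2)[OF 2(1)] 2 by (simp add: ennreal_mult_top)
    with member_le_sum[OF 2(1) _ assms(1), of "\<lambda>i. ennreal (\<theta> i) * x i"]
    have "(\<Sum>i\<in>I. ennreal (\<theta> i) * x i) = \<top>"
      by (simp add: top_unique)
    then show ?thesis by simp
  qed
next
  case False
  define y where "y i = enn2real (x i)" for i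
  have y: "x i = ennreal (y i)" "y i > 0" if "i \<in> I" for i
    using False that by (auto simp: y_def enn2real_positive_iff less_top zero_less_iff_neq_zero)
  have "(\<Prod>i\<in>I. epowr (x i) (\<theta> i)) = (\<Prod>i\<in>I. ennreal (y i powr \<theta> i))"
    using y by (intro prod.cong) (auto simp: epowr_ennreal less_imp_le)
  also have "\<dots> = ennreal (\<Prod>i\<in>I. y i powr \<theta> i)"
    by (rule prod_ennreal) auto
  also have "\<dots> \<le> ennreal (\<Sum>i\<in>I. \<theta> i * y i)"
    using assms y by (intro ennreal_leI weighted_arith_geom_mean) (auto simp: less_imp_le)
  also have "\<dots> = (\<Sum>i\<in>I. ennreal (\<theta> i * y i))"
    using assms y by (subst sum_ennreal) (auto simp: less_imp_le)
  also have "\<dots> = (\<Sum>i\<in>I. ennreal (\<theta> i) * x i)"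
    using assms y by (intro sum.cong) (auto simp: ennreal_mult less_imp_le)
  finally show ?thesis .
qed

text \<open>After division of each \<open>F i\<close> by its integral, the weighted mean inequality
  holds pointwise, and its right side integrates to the sum of the weights, which is 1.\<close>

lemma nn_integral_Holder:
  fixes F :: "'i \<Rightarrow> 'a \<Rightarrow> ennreal"
  assumes I: "finite I" "\<And>i. i \<in> I \<Longrightarrow> \<theta> i > 0" "sum \<theta> I = 1"
    and [measurable]: "\<And>i. i \<in> I \<Longrightarrow> F i \<in> borel_measurable M"
  shows "(\<integral>\<^sup>+x. (\<Prod>i\<in>I. epowr (F i x) (\<theta> i)) \<partial>M) \<le> (\<Prod>i\<in>I. epowr (\<integral>\<^sup>+x. F i x \<partial>M) (\<theta> i))"
proof -
  define J where "J i = (\<integral>\<^sup>+x. F i x \<partial>M)" for i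
  \<comment> \<open>A vanishing integral has to be treated before an infinite one: since 0 times
    \<top> is 0, an infinite factor makes the right side infinite only if no factor is 0.\<close>
  consider i where "i \<in> I" "J i = 0" | i where "\<And>i. i \<in> I \<Longrightarrow> J i \<noteq> 0" "i \<in> I" "J i = \<top>"
    | "\<And>i. i \<in> I \<Longrightarrow> J i \<noteq> 0" "\<And>i. i \<in> I \<Longrightarrow> J i \<noteq> \<top>" by blast
  then show ?thesis
  proof cases
    case 1
    then have "AE x in M. F i x = 0"
      by (simp add: J_def nn_integral_0_iff_AE)
    then have "AE x in M. (\<Prod>i\<in>I. epowr (F i x) (\<theta> i)) = 0"
      using 1 I(1) by (auto simp: prod_zero_iff elim!: eventually_mono)
    then have "(\<integral>\<^sup>+x. (\<Prod>i\<in>I. epowr (F i x) (\<theta> i)) \<partial>M) = (\<integral>\<^sup>+x. 0 \<partial>M)"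
      by (intro nn_integral_cong_AE) auto
    then show ?thesis by simp
  next
    case 2
    have "(\<Prod>i\<in>I. epowr (J i) (\<theta> i)) = \<top>"
      by (rule ennreal_prod_eq_top[of I i]) (use 2 I in auto)
    then show ?thesis by (simp add: J_def)
  next
    case 3
    define P where "P = (\<Prod>i\<in>I. epowr (J i) (\<theta> i))"
    have "(\<Prod>i\<in>I. epowr (F i x) (\<theta> i)) \<le> P * (\<Sum>i\<in>I. ennreal (\<theta> i) * (inverse (J i) * F i x))" for x
    proof -
      have "(\<Prod>i\<in>I. epowr (F i x) (\<theta> i)) = (\<Prod>i\<in>I. epowr (J i) (\<theta> i) * epowr (inverse (J i) * F i x) (\<theta> i))"
      proof (rule prod.cong[OF refl])
        fix i assume "i \<in> I"
        then show "epowr (F i x) (\<theta> i) = epowr (J i) (\<theta> i) * epowr (inverse (J i) * F i x) (\<theta> i)"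
          using 3 I(2) by (simp add: epowr_mult[symmetric] mult.assoc[symmetric] ennreal_inverse_mult
              ennreal_mult_divide_eq less_top zero_less_iff_neq_zero ennreal_divide_self divide_ennreal_def[symmetric])
      qed
      also have "\<dots> = P * (\<Prod>i\<in>I. epowr (inverse (J i) * F i x) (\<theta> i))"
        by (simp add: P_def prod.distrib)
      also have "\<dots> \<le> P * (\<Sum>i\<in>I. ennreal (\<theta> i) * (inverse (J i) * F i x))"
        by (intro mult_left_mono weighted_arith_geom_mean_ennreal I) auto
      finally show ?thesis .
    qed
    then have "(\<integral>\<^sup>+x. (\<Prod>i\<in>I. epowr (F i x) (\<theta> i)) \<partial>M)
       \<le> (\<integral>\<^sup>+x. P * (\<Sum>i\<in>I. ennreal (\<theta> i) * (inverse (J i) * F i x)) \<partial>M)"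
      by (intro nn_integral_mono) auto
    also have "\<dots> = P * (\<Sum>i\<in>I. ennreal (\<theta> i) * (inverse (J i) * J i))"
      by (simp add: nn_integral_cmult nn_integral_sum J_def)
    also have "(\<Sum>i\<in>I. ennreal (\<theta> i) * (inverse (J i) * J i)) = (\<Sum>i\<in>I. ennreal (\<theta> i))"
      using 3 by (intro sum.cong refl)
        (simp add: mult.commute[of "inverse _"] divide_ennreal_def[symmetric] ennreal_divide_self less_top zero_less_iff_neq_zero)
    also have "\<dots> = 1"
      using I by (simp add: sum_ennreal less_imp_le)
    finally show ?thesis by (simp add: P_def J_def)
  qed
qed

section \<open>Norms of extended nonnegative functions\<close>

definition eLp :: "'a measure \<Rightarrow> real \<Rightarrow> ('a \<Rightarrow> ennreal) \<Rightarrow> ennreal" where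
  "eLp M s F = epowr (\<integral>\<^sup>+x. epowr (F x) s \<partial>M) (1 / s)"

lemma epowr_eLp: "s > 0 \<Longrightarrow> epowr (eLp M s F) s = (\<integral>\<^sup>+x. epowr (F x) s \<partial>M)"
  by (simp add: eLp_def epowr_epowr)

lemma eLp_mono:
  assumes "s > 0" "\<And>x. x \<in> space M \<Longrightarrow> F x \<le> G x"
  shows "eLp M s F \<le> eLp M s G"
  unfolding eLp_def using assms by (intro epowr_mono nn_integral_mono) auto

lemma eLp_cmult:
  assumes "s > 0" and [measurable]: "F \<in> borel_measurable M"
  shows "eLp M s (\<lambda>x. c * F x) = c * eLp M s F"
  using assms(1) by (simp add: eLp_def epowr_mult nn_integral_cmult epowr_epowr)

lemma eLp_1: "eLp M 1 F = (\<integral>\<^sup>+x. F x \<partial>M)"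
  by (simp add: eLp_def)

text \<open>The preceding inequality for the powers \<open>epowr (F i x) (s i)\<close> with weights
  q / s_i, which add up to 1.\<close>

lemma Holder_eLp:
  fixes F :: "'i \<Rightarrow> 'a \<Rightarrow> ennreal"
  assumes I: "finite I" "\<And>i. i \<in> I \<Longrightarrow> s i > 0" "(\<Sum>i\<in>I. 1 / s i) = 1 / q" "q > 0"
    and [measurable]: "\<And>i. i \<in> I \<Longrightarrow> F i \<in> borel_measurable M"
  shows "eLp M q (\<lambda>x. \<Prod>i\<in>I. F i x) \<le> (\<Prod>i\<in>I. eLp M (s i) (F i))"
proof -
  have "(\<integral>\<^sup>+x. epowr (\<Prod>i\<in>I. F i x) q \<partial>M) = (\<integral>\<^sup>+x. (\<Prod>i\<in>I. epowr (epowr (F i x) (s i)) (q / s i)) \<partial>M)"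
    using I(2,4) by (intro nn_integral_cong) (auto simp: epowr_prod epowr_epowr intro!: prod.cong dest: I(2))
  also have "\<dots> \<le> (\<Prod>i\<in>I. epowr (\<integral>\<^sup>+x. epowr (F i x) (s i) \<partial>M) (q / s i))"
  proof (rule nn_integral_Holder)
    have "(\<Sum>i\<in>I. q / s i) = q * (\<Sum>i\<in>I. 1 / s i)"
      by (simp add: sum_distrib_left)
    then show "(\<Sum>i\<in>I. q / s i) = 1" using I by simp
  qed (use I in auto)
  also have "\<dots> = epowr (\<Prod>i\<in>I. eLp M (s i) (F i)) q"
    using I(4) by (simp add: epowr_prod eLp_def epowr_epowr)
  finally show ?thesis
    using I(4) by (simp add: eLp_def epowr_le_iff)
qed

lemma nn_integral_count_space_ge_point:
  assumes "i \<in> I"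
  shows "f i \<le> (\<integral>\<^sup>+i. f i \<partial>count_space I)"
  using nn_integral_ge_point[OF assms, of f] by simp

text \<open>Hoelder's inequality on the index set, applied with weights \<open>A\<^sub>i = \<parallel>F\<^sub>i\<parallel>\<close>, gives
  \<open>(\<Sum>F\<^sub>i)\<^sup>s \<le> (\<Sum>A\<^sub>i)\<^bsup>s-1\<^esup> \<Sum>A\<^sub>i\<^bsup>1-s\<^esup> F\<^sub>i\<^sup>s\<close> pointwise; it remains to integrate.\<close>
lemma Minkowski_eLp:
  fixes F :: "'i \<Rightarrow> 'a \<Rightarrow> ennreal"
  assumes I: "countable I" and s: "s \<ge> 1"
    and meas: "\<And>i. i \<in> I \<Longrightarrow> F i \<in> borel_measurable M"
  shows "eLp M s (\<lambda>x. \<integral>\<^sup>+i. F i x \<partial>count_space I) \<le> (\<integral>\<^sup>+i. eLp M s (F i) \<partial>count_space I)"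
proof (cases "s = 1")
  case True
  then show ?thesis
    using nn_integral_count_space_nn_integral[OF I meas] by (simp add: eLp_1)
next
  case False
  with s have s: "s > 1" by simp
  note [measurable] = meas
  define A where "A i = eLp M s (F i)" for i
  define T where "T = (\<integral>\<^sup>+i. A i \<partial>count_space I)"
  show ?thesis
  proof (cases "T = \<top>")
    case True
    then show ?thesis by (simp add: T_def A_def)
  next
    case False
    have fin: "A i \<noteq> \<top>" if "i \<in> I" for i
      using nn_integral_count_space_ge_point[OF that, of A] False by (auto simp: T_def top_unique)
    \<comment> \<open>Where \<open>A i\<close> is 0 the weights cannot be cancelled, because the
      zeroth power of 0 is 0 here. Such an \<open>F i\<close> vanishes off a null set, and
      countability of \<open>I\<close> merges these sets into one.\<close>
    have "AE x in M. A i = 0 \<longrightarrow> F i x = 0" if "i \<in> I" for i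
    proof (cases "A i = 0")
      case True
      then have "(\<integral>\<^sup>+x. epowr (F i x) s \<partial>M) = 0"
        using epowr_eLp[of s M "F i"] s by (simp add: A_def)
      then have "AE x in M. epowr (F i x) s = 0"
        using that by (subst (asm) nn_integral_0_iff_AE) auto
      then show ?thesis by auto
    qed simp
    then have "AE x in M. \<forall>i\<in>I. A i = 0 \<longrightarrow> F i x = 0"
      using I by (simp add: AE_ball_countable)
    then have "AE x in M. epowr (\<integral>\<^sup>+i. F i x \<partial>count_space I) s
        \<le> epowr T (s - 1) * (\<integral>\<^sup>+i. epowr (A i) (1 - s) * epowr (F i x) s \<partial>count_space I)"
    proof eventually_elim
      fix x assume zero: "\<forall>i\<in>I. A i = 0 \<longrightarrow> F i x = 0"
      \<comment> \<open>Two-factor Hoelder on the index set, the factors being indexed by truth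
        values: \<open>True\<close> carries the weights with exponent 1 - 1/s, \<open>False\<close>
        the weighted powers with exponent 1/s.\<close>
      define G where "G b i = (if b then A i else epowr (A i) (1 - s) * epowr (F i x) s)" for b i
      define \<theta> where "\<theta> b = (if b then 1 - 1 / s else 1 / s)" for b
      have "F i x = (\<Prod>b\<in>UNIV. epowr (G b i) (\<theta> b))" if "i \<in> I" for i
      proof -
        have "epowr (A i) (1 - 1 / s) * epowr (epowr (A i) (1 - s) * epowr (F i x) s) (1 / s) =
          epowr (A i) (1 - 1 / s + (1 - s) * (1 / s)) * F i x"
          unfolding epowr_add using s by (simp add: epowr_mult epowr_epowr mult.assoc)
        also have "1 - 1 / s + (1 - s) * (1 / s) = 0"
          using s by (simp add: field_simps)
        also have "epowr (A i) 0 * F i x = F i x"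
          using zero that fin[OF that] by (auto simp: epowr_def enn2real_eq_0_iff)
        finally show ?thesis by (simp add: G_def \<theta>_def UNIV_bool mult.commute)
      qed
      then have "(\<integral>\<^sup>+i. F i x \<partial>count_space I) = (\<integral>\<^sup>+i. (\<Prod>b\<in>UNIV. epowr (G b i) (\<theta> b)) \<partial>count_space I)"
        by (intro nn_integral_cong) auto
      also have "\<dots> \<le> (\<Prod>b\<in>UNIV. epowr (\<integral>\<^sup>+i. G b i \<partial>count_space I) (\<theta> b))"
        using s by (intro nn_integral_Holder) (auto simp: \<theta>_def UNIV_bool)
      finally have "epowr (\<integral>\<^sup>+i. F i x \<partial>count_space I) s \<le> epowr (\<Prod>b\<in>UNIV. epowr (\<integral>\<^sup>+i. G b i \<partial>count_space I) (\<theta> b)) s"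
        using s by (intro epowr_mono) auto
      also have "\<dots> = epowr T ((1 - 1 / s) * s) * (\<integral>\<^sup>+i. epowr (A i) (1 - s) * epowr (F i x) s \<partial>count_space I)"
        using s by (simp add: epowr_prod UNIV_bool G_def \<theta>_def epowr_epowr T_def epowr_mult mult.commute)
      also have "(1 - 1 / s) * s = s - 1" using s by (simp add: field_simps)
      finally show "epowr (\<integral>\<^sup>+i. F i x \<partial>count_space I) s
        \<le> epowr T (s - 1) * (\<integral>\<^sup>+i. epowr (A i) (1 - s) * epowr (F i x) s \<partial>count_space I)" .
    qed
    then have "(\<integral>\<^sup>+x. epowr (\<integral>\<^sup>+i. F i x \<partial>count_space I) s \<partial>M)
      \<le> (\<integral>\<^sup>+x. epowr T (s - 1) * (\<integral>\<^sup>+i. epowr (A i) (1 - s) * epowr (F i x) s \<partial>count_space I) \<partial>M)"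
      by (rule nn_integral_mono_AE)
    also have "\<dots> = (\<integral>\<^sup>+x. (\<integral>\<^sup>+i. epowr T (s - 1) * (epowr (A i) (1 - s) * epowr (F i x) s) \<partial>count_space I) \<partial>M)"
      by (simp add: nn_integral_cmult)
    also have "\<dots> = (\<integral>\<^sup>+i. (\<integral>\<^sup>+x. epowr T (s - 1) * (epowr (A i) (1 - s) * epowr (F i x) s) \<partial>M) \<partial>count_space I)"
      using I by (intro nn_integral_count_space_nn_integral) auto
    also have "\<dots> = (\<integral>\<^sup>+i. epowr T (s - 1) * A i \<partial>count_space I)"
    proof (intro nn_integral_cong)
      fix i assume "i \<in> space (count_space I)"
      then have i [simp]: "i \<in> I" by simp
      have "(\<integral>\<^sup>+x. epowr (A i) (1 - s) * epowr (F i x) s \<partial>M) = epowr (A i) (1 - s) * epowr (A i) s"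
        using s by (simp add: nn_integral_cmult A_def epowr_eLp)
      then show "(\<integral>\<^sup>+x. epowr T (s - 1) * (epowr (A i) (1 - s) * epowr (F i x) s) \<partial>M) = epowr T (s - 1) * A i"
        by (simp add: nn_integral_cmult flip: epowr_add)
    qed
    also have "\<dots> = epowr T s"
      using epowr_add[of T "s - 1" 1] by (simp add: nn_integral_cmult flip: T_def)
    finally have "eLp M s (\<lambda>x. \<integral>\<^sup>+i. F i x \<partial>count_space I) \<le> T"
      using s by (simp add: eLp_def epowr_le_iff)
    then show ?thesis by (simp add: T_def A_def)
  qed
qed

text \<open>Turns the unordered sums of the definitions into integrals over a counting measure, so
  that Hoelder, Minkowski and Tonelli cover sums over \<gamma> and k as well. An enumeration reduces
  it to series over the natural numbers.\<close>

lemma infsum_ennreal_eq_nn_integral: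
  fixes f :: "'i \<Rightarrow> ennreal"
  assumes "countable A"
  shows "infsum f A = (\<integral>\<^sup>+i. f i \<partial>count_space A)"
proof -
  define B where "B = to_nat_on A ` A"
  define g where "g n = f (from_nat_into A n)" for n
  have bij: "bij_betw (to_nat_on A) A B"
    using assms by (simp add: B_def bij_betw_def inj_on_to_nat_on)
  have g: "g (to_nat_on A a) = f a" if "a \<in> A" for a
    using assms that by (simp add: g_def)
  have "infsum f A = infsum (\<lambda>a. g (to_nat_on A a)) A"
    by (intro infsum_cong) (simp add: g)
  also have "\<dots> = infsum g B"
    by (rule infsum_reindex_bij_betw[OF bij])
  also have "\<dots> = infsum (\<lambda>n. g n * indicator B n) UNIV"
    by (rule infsum_cong_neutral) auto
  also have "\<dots> = (\<Sum>n. g n * indicator B n)"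
    by (intro sums_unique has_sum_imp_sums has_sum_infsum nonneg_summable_on_complete) auto
  also have "\<dots> = (\<integral>\<^sup>+n. g n \<partial>count_space B)"
    by (subst nn_integral_count_space_nat[symmetric], subst nn_integral_count_space_indicator) auto
  also have "\<dots> = (\<integral>\<^sup>+a. g (to_nat_on A a) \<partial>count_space A)"
    by (rule nn_integral_bij_count_space[OF bij, symmetric])
  also have "\<dots> = (\<integral>\<^sup>+i. f i \<partial>count_space A)"
    by (intro nn_integral_cong) (simp add: g)
  finally show ?thesis .
qed

text \<open>For complex terms summability is absolute summability; without it the sum is 0 by
  default and the bound is trivial.\<close>

lemma ennreal_norm_infsum_le:
  fixes f :: "'i \<Rightarrow> complex"
  assumes "countable A"
  shows "ennreal (norm (infsum f A)) \<le> (\<integral>\<^sup>+i. ennreal (norm (f i)) \<partial>count_space A)"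
proof (cases "f summable_on A")
  case True
  then have abs: "(\<lambda>x. norm (f x)) summable_on A"
    by (simp add: summable_on_iff_abs_summable_on_complex)
  then have "ennreal (norm (infsum f A)) \<le> ennreal (infsum (\<lambda>x. norm (f x)) A)"
    by (intro ennreal_leI norm_infsum_bound)
  also have "\<dots> = infsum (\<lambda>i. ennreal (norm (f i))) A"
    using infsum_nonneg_is_SUPREMUM_ennreal[OF abs] by (simp add: nonneg_infsum_complete sum_ennreal)
  finally show ?thesis by (simp add: infsum_ennreal_eq_nn_integral assms)
qed (simp add: infsum_not_exists)

lemma eLp_const:
  assumes "s > 0"
  shows "eLp M s (\<lambda>_. c) = c * epowr (emeasure M (space M)) (1 / s)"
  using assms by (simp add: eLp_def epowr_mult epowr_epowr)

text \<open>Minkowski's inequality with the two truth values as index set.\<close>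

lemma eLp_add_le:
  assumes s: "s \<ge> 1" and [measurable]: "F \<in> borel_measurable M" "G \<in> borel_measurable M"
  shows "eLp M s (\<lambda>x. F x + G x) \<le> eLp M s F + eLp M s G"
proof -
  have "eLp M s (\<lambda>x. \<integral>\<^sup>+b. (if b then F x else G x) \<partial>count_space UNIV)
     \<le> (\<integral>\<^sup>+b. eLp M s (if b then F else G) \<partial>count_space UNIV)"
    using Minkowski_eLp[of UNIV s "\<lambda>b. if b then F else G" M] s
    by (simp add: if_distrib[of "\<lambda>f. f _"] if_distribR)
  then show ?thesis
    by (simp add: nn_integral_count_space_finite UNIV_bool add.commute)
qed

text \<open>Hoelder against the constant 1. For r = 1 there is no finite conjugate exponent, and the
  zeroth power of the total mass is 1 only because the mass is neither 0 nor \<top>.\<close>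

lemma nn_integral_le_eLp:
  assumes r: "r \<ge> 1" and [measurable]: "F \<in> borel_measurable M"
    and fin: "emeasure M (space M) \<noteq> 0" "emeasure M (space M) \<noteq> \<top>"
  shows "(\<integral>\<^sup>+x. F x \<partial>M) \<le> eLp M r F * epowr (emeasure M (space M)) (1 - 1 / r)"
proof (cases "r = 1")
  case True
  moreover have "epowr (emeasure M (space M)) 0 = 1"
    using fin by (simp add: epowr_def enn2real_eq_0_iff)
  ultimately show ?thesis by (simp add: eLp_1)
next
  case False
  with r have r: "r > 1" by simp
  define s where "s b = (if b then r else r / (r - 1))" for b
  have "(\<integral>\<^sup>+x. F x \<partial>M) = eLp M 1 (\<lambda>x. \<Prod>b\<in>UNIV. if b then F x else 1)"
    by (simp add: eLp_1 UNIV_bool)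
  also have "\<dots> \<le> (\<Prod>b\<in>UNIV. eLp M (s b) (\<lambda>x. if b then F x else 1))"
    using r by (intro Holder_eLp) (auto simp: s_def UNIV_bool field_simps)
  also have "\<dots> = eLp M r F * epowr (emeasure M (space M)) (1 - 1 / r)"
    using r eLp_const[of "r / (r - 1)" M 1] by (simp add: UNIV_bool s_def mult.commute diff_divide_distrib)
  finally show ?thesis .
qed

text \<open>Tonelli: with equal inner and outer exponents the two outer roots and powers cancel.
  This joins the norm in x and the norm in y into one norm on which factors of both variables can be
  separated.\<close>

lemma eLp_pair:
  assumes N: "sigma_finite_measure N" and q: "q > 0"
    and [measurable]: "G \<in> borel_measurable (M \<Otimes>\<^sub>M N)"
  shows "eLp M q (\<lambda>x. eLp N q (\<lambda>y. G (x, y))) = eLp (M \<Otimes>\<^sub>M N) q G"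
proof -
  interpret N: sigma_finite_measure N by fact
  show ?thesis
    unfolding eLp_def using q
    by (simp add: epowr_epowr N.nn_integral_fst[of "\<lambda>z. epowr (G z) q", symmetric])
qed

lemma eLp_pair_fst:
  assumes N: "sigma_finite_measure N" and q: "q > 0"
    and [measurable]: "F \<in> borel_measurable M"
  shows "eLp (M \<Otimes>\<^sub>M N) q (\<lambda>z. F (fst z)) = epowr (emeasure N (space N)) (1 / q) * eLp M q F"
  using eLp_pair[OF N q, of "\<lambda>z. F (fst z)" M] q
  by (simp add: eLp_const eLp_cmult mult.commute[of "F _"])

lemma eLp_pair_snd:
  assumes N: "sigma_finite_measure N" and q: "q > 0"
    and [measurable]: "F \<in> borel_measurable N"
  shows "eLp (M \<Otimes>\<^sub>M N) q (\<lambda>z. F (snd z)) = epowr (emeasure M (space M)) (1 / q) * eLp N q F"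
  using eLp_pair[OF N q, of "\<lambda>z. F (snd z)" M] q
  by (simp add: eLp_const mult.commute)

lemma ennreal_norm_integral_le:
  fixes f :: "'a \<Rightarrow> complex"
  shows "ennreal (norm (integral\<^sup>L M f)) \<le> (\<integral>\<^sup>+x. ennreal (norm (f x)) \<partial>M)"
  by (cases "integrable M f") (auto simp: integral_norm_bound_ennreal not_integrable_integral_eq)

lemma ennreal_norm_prod:
  fixes f :: "'i \<Rightarrow> complex"
  shows "ennreal (norm (\<Prod>i\<in>I. f i)) = (\<Prod>i\<in>I. ennreal (norm (f i)))"
  by (simp add: prod_norm[symmetric] prod_ennreal)

text \<open>An infimum in the extended reals is reached along a sequence, so countably many null
  sets suffice. It says that the essential supremum is itself an essential bound, as needed for q =
  1.\<close>

lemma AE_le_Inf: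
  fixes A :: "ennreal set"
  assumes "A = {c. AE y in M. P y \<longrightarrow> h y \<le> c}"
  shows "AE y in M. P y \<longrightarrow> h y \<le> Inf A"
proof -
  have "A \<noteq> {}" using assms top_greatest by (auto intro!: exI[of _ \<top>])
  then obtain c :: "nat \<Rightarrow> ennreal" where c: "range c \<subseteq> A" "Inf A = (INF i. c i)"
    using ennreal_Inf_countable_INF by blast
  then have "AE y in M. P y \<longrightarrow> h y \<le> c i" for i
    using assms by auto
  then have "AE y in M. \<forall>i. P y \<longrightarrow> h y \<le> c i"
    unfolding AE_all_countable by blast
  then show ?thesis
    unfolding c(2) by (rule AE_mp) (auto intro!: AE_I2 INF_greatest)
qed

lemma ennreal_prod_neq_top:
  fixes f :: "'i \<Rightarrow> ennreal"
  assumes "\<And>i. i \<in> I \<Longrightarrow> f i \<noteq> \<top>"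
  shows "(\<Prod>i\<in>I. f i) \<noteq> \<top>"
  using assms by (induction I rule: infinite_finite_induct) (auto simp: ennreal_mult_eq_top_iff)

lemma measurable_nn_integral_count_space:
  fixes h :: "'i \<Rightarrow> 'a \<Rightarrow> ennreal"
  assumes "countable I" and [measurable]: "\<And>i. i \<in> I \<Longrightarrow> h i \<in> borel_measurable M"
  shows "(\<lambda>x. \<integral>\<^sup>+i. h i x \<partial>count_space I) \<in> borel_measurable M"
proof -
  have bij: "bij_betw (to_nat_on I) I (to_nat_on I ` I)"
    using assms(1) by (simp add: bij_betw_def inj_on_to_nat_on)
  have "(\<integral>\<^sup>+i. h i x \<partial>count_space I) = (\<Sum>k. if k \<in> to_nat_on I ` I then h (from_nat_into I k) x else 0)" for x
  proof -
    have "(\<integral>\<^sup>+i. h i x \<partial>count_space I) = (\<integral>\<^sup>+i. h (from_nat_into I (to_nat_on I i)) x \<partial>count_space I)"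
      using assms(1) by (intro nn_integral_cong) simp
    also have "\<dots> = (\<integral>\<^sup>+k. h (from_nat_into I k) x \<partial>count_space (to_nat_on I ` I))"
      by (rule nn_integral_bij_count_space[OF bij])
    also have "\<dots> = (\<integral>\<^sup>+k. (if k \<in> to_nat_on I ` I then h (from_nat_into I k) x else 0) \<partial>count_space UNIV)"
      by (subst nn_integral_count_space_indicator) (auto intro!: nn_integral_cong split: split_indicator)
    finally show ?thesis by (simp add: nn_integral_count_space_nat)
  qed
  moreover have "(\<lambda>x. if k \<in> to_nat_on I ` I then h (from_nat_into I k) x else 0) \<in> borel_measurable M" for k
    using assms by (cases "k \<in> to_nat_on I ` I") auto
  ultimately show ?thesis by simp
qed

locale padic =
  fixes p :: nat
  assumes p_ge_2: "p \<ge> 2"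
begin

lemma p_gt_1 [simp]: "real p > 1"
  using p_ge_2 by simp

lemma p_pos [simp]: "real p > 0"
  using p_ge_2 by simp

lemma p_nat_pos [simp]: "0 < p" "Suc 0 \<le> p"
  using p_ge_2 by simp_all

lemma p_powr_pos [simp]: "real p powr t > 0"
  using p_ge_2 by simp

text \<open>Being neither 0 nor \<top>, these powers can be multiplied and cancelled freely, so all
  bookkeeping of exponents becomes addition of real numbers.\<close>

definition ppow :: "real \<Rightarrow> ennreal" where
  "ppow t = ennreal (real p powr t)"

lemma ppow_0 [simp]: "ppow 0 = 1"
  using p_ge_2 by (simp add: ppow_def)

lemma ppow_add: "ppow (s + t) = ppow s * ppow t"
  by (simp add: ppow_def powr_add ennreal_mult)

lemma ppow_neq_0 [simp]: "ppow t \<noteq> 0"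
  using p_powr_pos[of t] by (simp add: ppow_def del: p_powr_pos)

lemma ppow_neq_top [simp]: "ppow t \<noteq> \<top>"
  by (simp add: ppow_def)

lemma ppow_power: "ppow t ^ k = ppow (real k * t)"
  by (induction k) (simp_all add: ppow_add[symmetric] algebra_simps)

subsection \<open>Balls and spheres in terms of digits\<close>

text \<open>The integers are not well-ordered, so the \<open>LEAST\<close> in \<open>qp_val\<close>
  exists only thanks to a bound \<open>N\<close> below which all digits vanish; the search runs over
  the natural offsets from \<open>N\<close>.\<close>

lemma qp_leading_digit:
  assumes "a \<in> Qp_carrier p" "a l \<noteq> 0"
  obtains v where "a v \<noteq> 0" "\<And>l. l < v \<Longrightarrow> a l = 0" "qp_val a = v"
proof -
  obtain N where N: "\<And>l. l < N \<Longrightarrow> a l = 0"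
    using assms(1) by (auto simp: Qp_carrier_def)
  define m where "m = (LEAST m. a (N + int m) \<noteq> 0)"
  have "N \<le> l" using N assms(2) by (meson not_le)
  then have ex: "a (N + int (nat (l - N))) \<noteq> 0" using assms(2) by simp
  have 1: "a (N + int m) \<noteq> 0"
    unfolding m_def by (rule LeastI[of "\<lambda>m. a (N + int m) \<noteq> 0", OF ex])
  have 2: "a l = 0" if "l < N + int m" for l
  proof (cases "l < N")
    case False
    then have "nat (l - N) < m" using that by linarith
    from not_less_Least[OF this[unfolded m_def]] False show ?thesis by simp
  qed (rule N)
  have "qp_val a = N + int m"
    unfolding qp_val_def by (rule Least_equality) (use 1 2 in \<open>auto intro: leI\<close>)
  with 1 2 that show ?thesis by blast
qed

lemma qp_norm_le_iff:
  assumes "a \<in> Qp_carrier p"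
  shows "qp_norm p a \<le> real p powr real_of_int k \<longleftrightarrow> (\<forall>l < -k. a l = 0)"
proof (cases "\<forall>l. a l = 0")
  case True
  then show ?thesis by (simp add: qp_norm_def)
next
  case False
  then obtain l where "a l \<noteq> 0" by blast
  with assms obtain v where v: "a v \<noteq> 0" "\<And>l. l < v \<Longrightarrow> a l = 0" "qp_val a = v"
    by (rule qp_leading_digit) blast
  have "qp_norm p a \<le> real p powr real_of_int k \<longleftrightarrow> - v \<le> k"
    using False v(3) p_ge_2 by (auto simp: qp_norm_def)
  also have "\<dots> \<longleftrightarrow> (\<forall>l < -k. a l = 0)"
    using v(1,2) by (metis minus_le_iff not_le order_less_le_trans)
  finally show ?thesis .
qed

lemma qp_norm_cases: "qp_norm p a = 0 \<or> (\<exists>j::int. qp_norm p a = real p powr real_of_int j)"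
  by (auto simp: qp_norm_def intro!: exI[of _ "- qp_val a"])

lemma qpn_norm_cases:
  fixes x :: "'n::finite qpn"
  obtains "qpn_norm p x = 0" | j :: int where "qpn_norm p x = real p powr real_of_int j"
proof -
  have "qpn_norm p x \<in> range (\<lambda>i. qp_norm p (x i))"
    unfolding qpn_norm_def by (intro Max_in) auto
  then obtain i where "qpn_norm p x = qp_norm p (x i)" by auto
  with qp_norm_cases[of "x i"] that show ?thesis by metis
qed

lemma powr_int_le_iff [simp]:
  "real p powr real_of_int i \<le> real p powr real_of_int j \<longleftrightarrow> i \<le> j"
  using p_ge_2 by simp

lemma powr_int_less_iff [simp]:
  "real p powr real_of_int i < real p powr real_of_int j \<longleftrightarrow> i < j"
  using p_ge_2 by simp

lemma powr_int_eq_iff [simp]: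
  "real p powr real_of_int i = real p powr real_of_int j \<longleftrightarrow> i = j"
  using powr_int_le_iff[of i j] powr_int_le_iff[of j i] by (metis order_antisym order_refl)

text \<open>In this form a ball is a countable intersection of conditions on single digits, hence
  measurable, and a dilation acts on it by shifting the index.\<close>

lemma ballp_eq:
  "ballp p k = {x :: 'n::finite qpn. \<forall>i l. x i l < p \<and> (l < -k \<longrightarrow> x i l = 0)}" (is "_ = ?B")
proof (intro equalityI subsetI)
  fix x :: "'n qpn" assume x: "x \<in> ballp p k"
  then have "qp_norm p (x i) \<le> real p powr real_of_int k" for i
    unfolding ballp_def qpn_norm_def by (auto simp: Max_le_iff)
  with x show "x \<in> ?B"
    by (auto simp: ballp_def Qpn_carrier_def qp_norm_le_iff) (auto simp: Qp_carrier_def)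
next
  fix x :: "'n qpn" assume x: "x \<in> ?B"
  then have C: "x \<in> Qpn_carrier p"
    by (auto simp: Qpn_carrier_def Qp_carrier_def intro!: exI[of _ "-k"])
  then have "qp_norm p (x i) \<le> real p powr real_of_int k" for i
    using x by (subst qp_norm_le_iff) (auto simp: Qpn_carrier_def)
  with C show "x \<in> ballp p k"
    unfolding ballp_def qpn_norm_def by (auto simp: Max_le_iff)
qed

lemma ballp_mono: "j \<le> k \<Longrightarrow> ballp p j \<subseteq> ballp p k"
  by (auto simp: ballp_def intro: order_trans)

text \<open>The norm takes only the values 0 and p^j, so no value lies strictly between p^(k-1) and
  p^k.\<close>

lemma sphp_eq: "sphp p k = ballp p k - ballp p (k - 1)"
proof (intro equalityI subsetI)
  fix x :: "'a qpn" assume x: "x \<in> ballp p k - ballp p (k - 1)"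
  then have *: "qpn_norm p x \<le> real p powr real_of_int k" "qpn_norm p x > real p powr real_of_int (k - 1)"
    "x \<in> Qpn_carrier p"
    by (auto simp: ballp_def)
  from * show "x \<in> sphp p k"
  proof (cases x rule: qpn_norm_cases)
    case 1
    then show ?thesis using * p_powr_pos[of "real_of_int (k-1)"] by linarith
  next
    case (2 j)
    with * have "j \<le> k" "k - 1 < j" by (simp_all del: of_int_diff)
    then have "j = k" by simp
    with * 2 show ?thesis by (simp add: sphp_def)
  qed
qed (auto simp: ballp_def sphp_def simp del: of_int_diff)

lemma sphp_subset_ballp: "j \<le> k \<Longrightarrow> sphp p j \<subseteq> ballp p k"
  using ballp_mono[of j k] by (auto simp: sphp_eq)

text \<open>On S_k the factor p^\<gamma> |x|^(-1) equals p^(\<gamma>-k), so the dilation inside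
  \<open>Hcomm\<close> no longer depends on the point x.\<close>

lemma sphp_normexp: "x \<in> sphp p k \<Longrightarrow> qpn_normexp p x = k"
  unfolding qpn_normexp_def sphp_def by (intro the_equality) auto

lemma scale_in_ballp: "qpn_ppow_scale j x \<in> ballp p k \<longleftrightarrow> x \<in> ballp p (k + j)"
proof
  assume H: "qpn_ppow_scale j x \<in> ballp p k"
  show "x \<in> ballp p (k + j)"
    unfolding ballp_eq
  proof (intro CollectI allI)
    fix i l
    show "x i l < p \<and> (l < - (k + j) \<longrightarrow> x i l = 0)"
      using H[unfolded ballp_eq mem_Collect_eq qpn_ppow_scale_def, rule_format, of i "l + j"] by simp
  qed
next
  assume H: "x \<in> ballp p (k + j)"
  show "qpn_ppow_scale j x \<in> ballp p k"
    unfolding ballp_eq qpn_ppow_scale_def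
  proof (intro CollectI allI)
    fix i l
    show "x i (l - j) < p \<and> (l < - k \<longrightarrow> x i (l - j) = 0)"
      using H[unfolded ballp_eq mem_Collect_eq, rule_format, of i "l - j"] by simp
  qed
qed

lemma scale_in_sphp: "qpn_ppow_scale j x \<in> sphp p k \<longleftrightarrow> x \<in> sphp p (k + j)"
  by (simp add: sphp_eq scale_in_ballp algebra_simps)

lemma space_haar [simp]: "space (haar p) = UNIV"
  by (simp add: haar_def qpn_space_def space_PiM)

lemma sets_haar: "sets (haar p) = sets (Pi\<^sub>M UNIV (\<lambda>_. Pi\<^sub>M UNIV (\<lambda>_. count_space UNIV)))"
  by (simp add: haar_def qpn_space_def)

lemma measurable_haar_cong: "measurable (haar p) N = measurable (Pi\<^sub>M UNIV (\<lambda>_. Pi\<^sub>M UNIV (\<lambda>_. count_space UNIV))) N"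
  by (rule measurable_cong_sets) (simp_all add: sets_haar)

lemma measurable_digit [measurable]: "(\<lambda>x. x i l) \<in> haar p \<rightarrow>\<^sub>M count_space UNIV"
proof -
  have "(\<lambda>x. x i) \<in> haar p \<rightarrow>\<^sub>M Pi\<^sub>M UNIV (\<lambda>_. count_space UNIV)"
    unfolding measurable_haar_cong by (rule measurable_component_singleton) simp
  moreover have "(\<lambda>a. a l) \<in> Pi\<^sub>M UNIV (\<lambda>_. count_space UNIV) \<rightarrow>\<^sub>M count_space UNIV"
    by (rule measurable_component_singleton) simp
  ultimately show ?thesis by (rule measurable_compose)
qed

lemma sets_ballp [measurable]: "ballp p k \<in> sets (haar p)"
proof -
  have "{x \<in> space (haar p). \<forall>i l. x i l < p \<and> (l < -k \<longrightarrow> x i l = 0)} \<in> sets (haar p)"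
    by measurable
  then show ?thesis by (simp add: ballp_eq)
qed

lemma sets_sphp [measurable]: "sphp p k \<in> sets (haar p)"
  by (simp add: sphp_eq)

lemma measurable_scale [measurable]: "qpn_ppow_scale j \<in> haar p \<rightarrow>\<^sub>M haar p"
proof -
  have "(\<lambda>y i k. y i (k - j)) \<in> haar p \<rightarrow>\<^sub>M Pi\<^sub>M UNIV (\<lambda>_. Pi\<^sub>M UNIV (\<lambda>_. count_space UNIV))"
    by (intro measurable_PiM_single') (auto simp: space_PiM)
  then show ?thesis
    unfolding qpn_ppow_scale_def[abs_def]
    by (subst measurable_cong_sets[OF refl sets_haar])
qed

subsection \<open>Scaling of Haar measure\<close>

abbreviation halfline :: "real measure" where
  "halfline \<equiv> restrict_space lborel {0..}"

lemma measurable_expansion [measurable]: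
  "(\<lambda>t i. padic_digits p (t i)) \<in> (Pi\<^sub>M UNIV (\<lambda>_::'n::finite. halfline)) \<rightarrow>\<^sub>M qpn_space"
proof -
  have [measurable]: "(\<lambda>t. t) \<in> borel_measurable halfline"
    by (intro measurable_restrict_space1) simp
  have [measurable]: "padic_digits p \<in> halfline \<rightarrow>\<^sub>M Pi\<^sub>M UNIV (\<lambda>_. count_space UNIV)"
    unfolding padic_digits_def[abs_def] by (intro measurable_PiM_single') (auto simp: space_PiM)
  show ?thesis
    unfolding qpn_space_def by (intro measurable_PiM_single') (auto simp: space_PiM)
qed

lemma sigma_finite_halfline: "sigma_finite_measure halfline"
  by (intro sigma_finite_measure_restrict_space) (auto intro: lborel.sigma_finite_measure_axioms)

sublocale halfline: product_sigma_finite "\<lambda>_. halfline"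
  by (simp add: product_sigma_finite_def sigma_finite_halfline)

lemma emeasure_halfline_scale:
  assumes "c > 0" "A \<in> sets halfline"
  shows "ennreal c * emeasure halfline {t. 0 \<le> t \<and> c * t \<in> A} = emeasure halfline A"
proof -
  have A: "A \<subseteq> {0..}" "A \<in> sets borel"
    using assms(2) by (auto simp: sets_restrict_space)
  have nonneg: "0 \<le> t" if "c * t \<in> A" for t
  proof -
    have "0 \<le> c * t" using A that by auto
    with \<open>c > 0\<close> show ?thesis by (simp add: zero_le_mult_iff)
  qed
  then have "{t. 0 \<le> t \<and> c * t \<in> A} = (*) c -` A" by auto
  moreover have "(*) c -` A \<subseteq> {0..}" using nonneg by auto
  moreover have "emeasure (distr lborel borel ((*) c)) A = emeasure lborel ((*) c -` A)"
    using A by (simp add: emeasure_distr)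
  moreover have "emeasure (distr lborel borel ((*) c)) A = ennreal (inverse c) * emeasure lborel A"
    using A \<open>c > 0\<close> by (simp add: lborel_distr_mult emeasure_density_const)
  ultimately have "ennreal c * emeasure halfline {t. 0 \<le> t \<and> c * t \<in> A} = ennreal c * (ennreal (inverse c) * emeasure lborel A)"
    using A \<open>c > 0\<close> by (simp add: emeasure_restrict_space)
  also have "\<dots> = emeasure lborel A"
    using \<open>c > 0\<close> by (simp add: mult.assoc[symmetric] ennreal_mult[symmetric])
  finally show ?thesis using A by (simp add: emeasure_restrict_space)
qed

lemma measurable_halfline_scale:
  assumes "c > 0"
  shows "(\<lambda>t i. c * t i) \<in> Pi\<^sub>M UNIV (\<lambda>_::'n::finite. halfline) \<rightarrow>\<^sub>M Pi\<^sub>M UNIV (\<lambda>_. halfline)"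
proof (intro measurable_PiM_single')
  show "(\<lambda>t. c * t i) \<in> Pi\<^sub>M UNIV (\<lambda>_::'n. halfline) \<rightarrow>\<^sub>M halfline" for i
  proof (rule measurable_restrict_space2)
    have [measurable]: "(\<lambda>t. t) \<in> borel_measurable halfline"
      by (intro measurable_restrict_space1) simp
    show "(\<lambda>t. c * t i) \<in> Pi\<^sub>M UNIV (\<lambda>_::'n. halfline) \<rightarrow>\<^sub>M lborel"
      by (simp add: measurable_lborel1)
  qed (use assms in \<open>auto simp: space_PiM PiE_iff\<close>)
qed (use assms in \<open>auto simp: space_PiM PiE_iff\<close>)

text \<open>A product measure is determined by its values on rectangles, where one factor c is
  absorbed by each coordinate.\<close>

lemma halfline_power_scale:
  assumes "c > 0"
  shows "scale_measure (ennreal c ^ CARD('n::finite))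
      (distr (Pi\<^sub>M UNIV (\<lambda>_::'n. halfline)) (Pi\<^sub>M UNIV (\<lambda>_. halfline)) (\<lambda>t i. c * t i))
    = Pi\<^sub>M UNIV (\<lambda>_::'n. halfline)"
proof (rule halfline.PiM_eqI)
  note meas = measurable_halfline_scale[OF assms, where 'n='n]
  fix A :: "'n \<Rightarrow> real set" assume A: "\<And>i. i \<in> UNIV \<Longrightarrow> A i \<in> sets halfline"
  define B where "B i = {t. 0 \<le> t \<and> c * t \<in> A i}" for i
  have B: "B i \<in> sets halfline" for i
  proof -
    have "A i \<in> sets borel" using A[of i] by (auto simp: sets_restrict_space)
    then have "(*) c -` A i \<inter> space borel \<in> sets borel"
      by (intro measurable_sets) auto
    then show ?thesis by (auto simp: sets_restrict_space B_def intro!: image_eqI[of _ _ "(*) c -` A i"])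
  qed
  have "(\<lambda>t i. c * t i) -` Pi\<^sub>E UNIV A \<inter> space (Pi\<^sub>M UNIV (\<lambda>_. halfline)) = Pi\<^sub>E UNIV B"
    by (auto simp: B_def space_PiM PiE_iff)
  then have "emeasure (distr (Pi\<^sub>M UNIV (\<lambda>_::'n. halfline)) (Pi\<^sub>M UNIV (\<lambda>_. halfline)) (\<lambda>t i. c * t i)) (Pi\<^sub>E UNIV A)
      = emeasure (Pi\<^sub>M UNIV (\<lambda>_. halfline)) (Pi\<^sub>E UNIV B)"
    using A by (subst emeasure_distr[OF meas]) auto
  also have "\<dots> = (\<Prod>i\<in>UNIV. emeasure halfline (B i))"
    using B by (intro halfline.emeasure_PiM) auto
  finally have "emeasure (scale_measure (ennreal c ^ CARD('n)) (distr (Pi\<^sub>M UNIV (\<lambda>_::'n. halfline)) (Pi\<^sub>M UNIV (\<lambda>_. halfline)) (\<lambda>t i. c * t i))) (Pi\<^sub>E UNIV A)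
    = ennreal c ^ CARD('n) * (\<Prod>i\<in>UNIV. emeasure halfline (B i))"
    by simp
  also have "\<dots> = (\<Prod>i\<in>UNIV. ennreal c * emeasure halfline (B i))"
    by (simp add: prod.distrib)
  also have "\<dots> = (\<Prod>i\<in>UNIV. emeasure halfline (A i))"
    using A assms by (simp add: B_def emeasure_halfline_scale)
  finally show "emeasure (scale_measure (ennreal c ^ CARD('n)) (distr (Pi\<^sub>M UNIV (\<lambda>_::'n. halfline)) (Pi\<^sub>M UNIV (\<lambda>_. halfline)) (\<lambda>t i. c * t i))) (Pi\<^sub>E UNIV A)
    = (\<Prod>i\<in>UNIV. emeasure halfline (A i))" .
qed simp_all

lemma nn_integral_haar:
  fixes g :: "'n::finite qpn \<Rightarrow> ennreal"
  assumes "g \<in> borel_measurable (haar p)"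
  shows "(\<integral>\<^sup>+x. g x \<partial>haar p) = (\<integral>\<^sup>+t. g (\<lambda>i. padic_digits p (t i)) \<partial>Pi\<^sub>M UNIV (\<lambda>_. halfline))"
  using assms unfolding haar_def by (subst nn_integral_distr) auto

text \<open>Multiplying a p-adic number by p^j shifts its digits upwards by j, which for the real
  number with the same digits is multiplication by p^(-j).\<close>

lemma scale_padic_digits:
  "qpn_ppow_scale j (\<lambda>i. padic_digits p (t i)) = (\<lambda>i. padic_digits p (real p powr (- real_of_int j) * t i))"
proof -
  have "t i * real p powr (real_of_int (k - j) + 1) = real p powr (- real_of_int j) * t i * real p powr (real_of_int k + 1)" for i k
  proof -
    have "real_of_int (k - j) + 1 = - real_of_int j + (real_of_int k + 1)" by simp
    then have "real p powr (real_of_int (k - j) + 1) = real p powr (- real_of_int j) * real p powr (real_of_int k + 1)"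
      by (simp only: powr_add)
    then show ?thesis by (simp only: mult_ac)
  qed
  then show ?thesis unfolding qpn_ppow_scale_def padic_digits_def fun_eq_iff by (simp only: simp_thms)
qed

lemma nn_integral_haar_scale:
  fixes g :: "'n::finite qpn \<Rightarrow> ennreal"
  assumes [measurable]: "g \<in> borel_measurable (haar p)"
  shows "(\<integral>\<^sup>+y. g (qpn_ppow_scale j y) \<partial>haar p) = ppow (real_of_int j * real CARD('n)) * (\<integral>\<^sup>+z. g z \<partial>haar p)"
proof -
  \<comment> \<open>The real dilation has factor p^(-j), so its Jacobian p^(-jn) appears on the
    other side of the identity.\<close>
  define c where "c = real p powr (- real_of_int j)"
  have "c > 0" by (simp add: c_def)
  let ?M = "Pi\<^sub>M UNIV (\<lambda>_::'n. halfline)"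
  let ?D = "\<lambda>t i. padic_digits p (t i)"
  note meas = measurable_halfline_scale[OF \<open>c > 0\<close>, where 'n='n]
  have g: "(\<lambda>t. g (?D t)) \<in> borel_measurable ?M"
    using assms by (intro measurable_compose[OF measurable_expansion]) (simp add: haar_def)
  have "(\<integral>\<^sup>+z. g z \<partial>haar p) = (\<integral>\<^sup>+t. g (?D t) \<partial>?M)"
    by (rule nn_integral_haar) fact
  also have "\<dots> = (\<integral>\<^sup>+t. g (?D t) \<partial>scale_measure (ennreal c ^ CARD('n)) (distr ?M ?M (\<lambda>t i. c * t i)))"
    by (simp only: halfline_power_scale[OF \<open>c > 0\<close>])
  also have "\<dots> = ennreal c ^ CARD('n) * (\<integral>\<^sup>+t. g (?D (\<lambda>i. c * t i)) \<partial>?M)"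
    using g meas by (subst nn_integral_scale_measure) (auto simp: nn_integral_distr)
  also have "(\<integral>\<^sup>+t. g (?D (\<lambda>i. c * t i)) \<partial>?M) = (\<integral>\<^sup>+y. g (qpn_ppow_scale j y) \<partial>haar p)"
    by (subst nn_integral_haar) (auto simp: scale_padic_digits c_def)
  also have "ennreal c ^ CARD('n) = ppow (- (real_of_int j * real CARD('n)))"
    by (simp add: c_def ppow_power ppow_def[symmetric] mult.commute)
  finally have "ppow (real_of_int j * real CARD('n)) * (\<integral>\<^sup>+z. g z \<partial>haar p) =
     ppow (real_of_int j * real CARD('n)) * ppow (- (real_of_int j * real CARD('n))) * (\<integral>\<^sup>+y. g (qpn_ppow_scale j y) \<partial>haar p)"
    by (simp add: mult.assoc)
  then show ?thesis by (simp flip: ppow_add)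
qed

lemma nn_integral_unit_sphere_scale:
  fixes g :: "'n::finite qpn \<Rightarrow> ennreal"
  assumes [measurable]: "g \<in> borel_measurable (haar p)"
  shows "(\<integral>\<^sup>+y\<in>sphp p 0. g (qpn_ppow_scale j y) \<partial>haar p) =
    ppow (real_of_int j * real CARD('n)) * (\<integral>\<^sup>+z\<in>sphp p (-j). g z \<partial>haar p)"
  by (subst nn_integral_haar_scale[symmetric]) (auto simp: indicator_def scale_in_sphp intro!: nn_integral_cong)

subsection \<open>Measures of spheres and balls\<close>

text \<open>The mass of the unit sphere, that is 1 - p^(-n). The estimates below only involve 0 < s0
  \<le> 1.\<close>

definition s0 :: "'n::finite itself \<Rightarrow> ennreal" where
  "s0 _ = emeasure (haar p) (sphp p 0 :: 'n qpn set)"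

lemma emeasure_sphp:
  "emeasure (haar p) (sphp p k :: 'n::finite qpn set) = ppow (real_of_int k * real CARD('n)) * s0 TYPE('n)"
proof -
  have "emeasure (haar p) (sphp p k :: 'n::finite qpn set) = (\<integral>\<^sup>+y. indicator (sphp p 0) (qpn_ppow_scale k y :: 'n qpn) \<partial>haar p)"
    by (subst nn_integral_indicator[symmetric], simp, intro nn_integral_cong)
      (simp add: scale_in_sphp split: split_indicator)
  then show ?thesis
    by (simp add: nn_integral_haar_scale s0_def)
qed

lemma padic_digits_less: "padic_digits p t k < p"
  using p_ge_2 by (simp add: padic_digits_def nat_less_iff)

lemma padic_digits_eq_0:
  assumes "0 \<le> t" "t < 1" "k < 0"
  shows "padic_digits p t k = 0"
proof -
  have "real p powr (real_of_int k + 1) \<le> real p powr 0"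
    using assms(3) by (intro powr_mono) auto
  then have "t * real p powr (real_of_int k + 1) < 1"
    using assms p_powr_pos[of "real_of_int k + 1"] p_ge_2
    by (smt (verit) mult_left_le powr_zero_eq_one p_gt_1)
  moreover have "0 \<le> t * real p powr (real_of_int k + 1)" using assms by simp
  ultimately have "\<lfloor>t * real p powr (real_of_int k + 1)\<rfloor> = 0" by (simp add: floor_eq_iff)
  then show ?thesis by (simp add: padic_digits_def)
qed

text \<open>The digit of index k has weight p^(-k-1) in the real number t, so the power p^e belongs
  to the index -e-1; after rescaling, t lies between 1 and p.\<close>

lemma padic_digits_leading:
  assumes "real p powr real_of_int e \<le> t" "t < real p powr (real_of_int e + 1)"
  shows "padic_digits p t (- e - 1) \<noteq> 0"
proof -
  define u where "u = t * real p powr (real_of_int (- e - 1) + 1)"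
  have "u = t / real p powr real_of_int e" by (simp add: u_def powr_minus divide_inverse)
  then have "1 \<le> u" "u < real p"
    using assms p_ge_2 by (auto simp: powr_add field_simps)
  then have "1 \<le> \<lfloor>u\<rfloor>" "\<lfloor>u\<rfloor> < int p" by (auto simp: floor_less_iff)
  then show ?thesis by (simp add: padic_digits_def u_def)
qed

lemma padic_digits_nonzero:
  assumes "t \<ge> 1"
  obtains k where "k < 0" "padic_digits p t k \<noteq> 0"
proof -
  define e where "e = \<lfloor>log (real p) t\<rfloor>"
  have "e \<ge> 0" using assms p_ge_2 by (simp add: e_def)
  moreover have "real p powr real_of_int e \<le> t" "t < real p powr (real_of_int e + 1)"
    using assms p_ge_2 by (simp_all add: e_def powr_le_iff less_powr_iff)
  then have "padic_digits p t (- e - 1) \<noteq> 0" by (rule padic_digits_leading)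
  ultimately show ?thesis using that[of "- e - 1"] by simp
qed

text \<open>The preimage of S_0 under the digit expansion lies in the cube with a = 0 and contains
  the cube with a = 1/p; this bounds \<open>s0\<close> from both sides.\<close>

lemma emeasure_halfline_cube:
  assumes "0 \<le> a" "a \<le> 1"
  shows "Pi\<^sub>E UNIV (\<lambda>_. {a..<1}) \<in> sets (Pi\<^sub>M UNIV (\<lambda>_::'n::finite. halfline))"
    and "emeasure (Pi\<^sub>M UNIV (\<lambda>_::'n::finite. halfline)) (Pi\<^sub>E UNIV (\<lambda>_. {a..<1})) = ennreal (1 - a) ^ CARD('n)"
proof -
  have A: "{a..<1} \<in> sets halfline"
    using assms by (auto simp: sets_restrict_space intro!: image_eqI[of _ _ "{a..<1}"])
  show "Pi\<^sub>E UNIV (\<lambda>_. {a..<1}) \<in> sets (Pi\<^sub>M UNIV (\<lambda>_::'n::finite. halfline))"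
    using A by (intro sets_PiM_I_finite) auto
  show "emeasure (Pi\<^sub>M UNIV (\<lambda>_::'n::finite. halfline)) (Pi\<^sub>E UNIV (\<lambda>_. {a..<1})) = ennreal (1 - a) ^ CARD('n)"
  proof -
    have "emeasure halfline {a..<1} = ennreal (1 - a)"
      using assms by (subst emeasure_restrict_space) auto
    then show ?thesis
      using A by (subst halfline.emeasure_PiM) auto
  qed
qed

lemma emeasure_haar:
  assumes "A \<in> sets (haar p)"
  shows "emeasure (haar p) (A :: 'n::finite qpn set) =
    emeasure (Pi\<^sub>M UNIV (\<lambda>_. halfline)) {t. (\<forall>i. 0 \<le> t i) \<and> (\<lambda>i. padic_digits p (t i)) \<in> A}"
proof -
  have "(\<lambda>t i. padic_digits p (t i)) -` A \<inter> space (Pi\<^sub>M UNIV (\<lambda>_::'n. halfline)) =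
    {t. (\<forall>i. 0 \<le> t i) \<and> (\<lambda>i. padic_digits p (t i)) \<in> A}"
    by (auto simp: space_PiM PiE_iff)
  then show ?thesis
    using assms unfolding haar_def by (subst emeasure_distr) auto
qed

lemma s0_le_1: "s0 TYPE('n::finite) \<le> 1"
proof -
  have "s0 TYPE('n) \<le> emeasure (Pi\<^sub>M UNIV (\<lambda>_::'n::finite. halfline)) (Pi\<^sub>E UNIV (\<lambda>_. {0..<1}))"
    unfolding s0_def emeasure_haar[OF sets_sphp]
  proof (intro emeasure_mono subsetI)
    fix t :: "'n \<Rightarrow> real" assume t: "t \<in> {t. (\<forall>i. 0 \<le> t i) \<and> (\<lambda>i. padic_digits p (t i)) \<in> sphp p 0}"
    then have "(\<lambda>i. padic_digits p (t i)) \<in> ballp p 0" by (simp add: sphp_eq)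
    then have zero: "padic_digits p (t i) k = 0" if "k < 0" for i k
      using that by (simp add: ballp_eq)
    have "t i < 1" for i
    proof (rule ccontr)
      assume "\<not> t i < 1"
      then have "1 \<le> t i" by simp
      then obtain k where "k < 0" "padic_digits p (t i) k \<noteq> 0" by (rule padic_digits_nonzero)
      with zero[of k i] show False by simp
    qed
    with t show "t \<in> Pi\<^sub>E UNIV (\<lambda>_. {0..<1})" by (simp add: PiE_iff)
  next
    show "Pi\<^sub>E UNIV (\<lambda>_. {0..<1}) \<in> sets (Pi\<^sub>M UNIV (\<lambda>_::'n. halfline))"
      by (rule emeasure_halfline_cube) simp_all
  qed
  also have "\<dots> = ennreal (1 - 0) ^ CARD('n)"
    by (rule emeasure_halfline_cube) simp_all
  finally show ?thesis by simp
qed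

lemma s0_neq_top [simp]: "s0 TYPE('n::finite) \<noteq> \<top>"
  using s0_le_1[where 'n='n] by (auto simp: top_unique)

lemma s0_neq_0 [simp]: "s0 TYPE('n::finite) \<noteq> 0"
proof -
  have "emeasure (Pi\<^sub>M UNIV (\<lambda>_::'n::finite. halfline)) (Pi\<^sub>E UNIV (\<lambda>_. {1 / real p..<1})) \<le> s0 TYPE('n)"
    unfolding s0_def emeasure_haar[OF sets_sphp]
  proof (intro emeasure_mono subsetI)
    fix t :: "'n \<Rightarrow> real" assume "t \<in> Pi\<^sub>E UNIV (\<lambda>_. {1 / real p..<1})"
    then have t: "1 / real p \<le> t i" "t i < 1" for i by (auto simp: PiE_iff)
    then have t0: "0 \<le> t i" for i using order_trans[of 0 "1 / real p" "t i"] by simp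
    \<comment> \<open>A real number in [1/p, 1) has its leading digit at index 0, so every
      coordinate has norm exactly 1.\<close>
    have "padic_digits p (t i) 0 \<noteq> 0" for i
      using padic_digits_leading[of "-1" "t i"] t[of i] p_ge_2 by (simp add: powr_minus divide_inverse)
    moreover have "padic_digits p (t i) l = 0" if "l < 0" for i l
      by (rule padic_digits_eq_0) (use t0 t that in auto)
    ultimately have "(\<lambda>i. padic_digits p (t i)) \<in> sphp p 0"
      unfolding sphp_eq ballp_eq by (simp add: padic_digits_less) (metis zero_less_one)
    then show "t \<in> {t. (\<forall>i. 0 \<le> t i) \<and> (\<lambda>i. padic_digits p (t i)) \<in> sphp p 0}"
      using t0 by blast
  next
    show "{t. (\<forall>i. 0 \<le> t i) \<and> (\<lambda>i. padic_digits p (t i)) \<in> sphp p 0} \<in> sets (Pi\<^sub>M UNIV (\<lambda>_::'n. halfline))"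
    proof -
      have "{t. (\<forall>i. 0 \<le> t i) \<and> (\<lambda>i. padic_digits p (t i)) \<in> sphp p 0}
        = (\<lambda>t i. padic_digits p (t i)) -` sphp p 0 \<inter> space (Pi\<^sub>M UNIV (\<lambda>_::'n. halfline))"
        by (auto simp: space_PiM PiE_iff)
      also have "\<dots> \<in> sets (Pi\<^sub>M UNIV (\<lambda>_::'n. halfline))"
        using sets_sphp[of 0] by (intro measurable_sets[OF measurable_expansion]) (simp add: haar_def)
      finally show ?thesis .
    qed
  qed
  moreover have "emeasure (Pi\<^sub>M UNIV (\<lambda>_::'n::finite. halfline)) (Pi\<^sub>E UNIV (\<lambda>_. {1 / real p..<1})) = ennreal (1 - 1 / real p) ^ CARD('n)"
    by (rule emeasure_halfline_cube) (use p_ge_2 in auto)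
  moreover have "ennreal (1 - 1 / real p) \<noteq> 0"
    using p_ge_2 by (simp add: ennreal_eq_0_iff)
  ultimately show ?thesis
    by (metis le_zero_eq power_eq_0_iff)
qed

text \<open>The mass of the unit ball for the weight |x|^a, as a geometric series over the spheres
  S_(-i), each of Haar measure p^(-in) s0 and with constant weight p^(-ia).\<close>

definition w0 :: "'n::finite itself \<Rightarrow> real \<Rightarrow> ennreal" where
  "w0 T a = s0 T * (\<Sum>i. ppow (- (real i * (real CARD('n) + a))))"

lemma s0_le_w0: "s0 T \<le> w0 T a"
proof -
  have "(\<Sum>i\<in>{0}. ppow (- (real i * (real CARD('n) + a)))) \<le> (\<Sum>i. ppow (- (real i * (real CARD('n) + a))))"
    by (intro sum_le_suminf) auto
  then have "s0 T * 1 \<le> s0 T * (\<Sum>i. ppow (- (real i * (real CARD('n) + a))))"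
    by (intro mult_left_mono) auto
  then show ?thesis by (simp add: w0_def)
qed

lemma w0_neq_0 [simp]: "w0 TYPE('n::finite) a \<noteq> 0"
  using s0_le_w0[of "TYPE('n)" a] by auto

text \<open>The ratio of the geometric series is p^(-(n+a)), which is less than 1 exactly when a >
  -n.\<close>

lemma w0_neq_top:
  assumes "a > - real CARD('n::finite)"
  shows "w0 TYPE('n) a \<noteq> \<top>"
proof -
  define r where "r = real p powr (- (real CARD('n) + a))"
  have "r < 1" "r \<ge> 0"
    using assms p_ge_2 powr_less_cancel_iff[of "real p" "- (real CARD('n) + a)" 0] by (auto simp: r_def)
  then have "summable (\<lambda>i. r ^ i)" by (intro summable_geometric) auto
  moreover have "ppow (- (real i * (real CARD('n) + a))) = ennreal (r ^ i)" for i
    using ppow_power[of "- (real CARD('n) + a)" i] by (simp add: r_def ppow_def ennreal_power algebra_simps)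
  ultimately have "(\<Sum>i. ppow (- (real i * (real CARD('n) + a)))) \<noteq> \<top>"
    using \<open>r \<ge> 0\<close> by (simp add: ennreal_suminf_neq_top)
  then show ?thesis by (simp add: w0_def ennreal_mult_eq_top_iff)
qed

text \<open>The norm is meaningful only on p-adic points: for other digit functions the valuation is
  a \<open>LEAST\<close> that need not exist. Expanding the weight over spheres gives its
  measurability on a ball, and also the mass of the ball.\<close>

lemma weight_on_ball:
  fixes x :: "'n::finite qpn"
  shows "ennreal (qpn_norm p x powr a) * indicator (ballp p k) x =
    (\<Sum>i. ppow ((real_of_int k - real i) * a) * indicator (sphp p (k - int i)) x)"
proof (cases "x \<in> ballp p k")
  case False
  then have "x \<notin> sphp p (k - int i)" for i using sphp_subset_ballp[of "k - int i" k] by auto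
  with False show ?thesis by simp
next
  case True
  show ?thesis
  proof (cases x rule: qpn_norm_cases)
    \<comment> \<open>At the origin the convention 0 powr a = 0 makes the left side vanish also for
      negative a.\<close>
    case 1
    then have "x \<notin> sphp p (k - int i)" for i
      using p_powr_pos[of "real_of_int (k - int i)"] by (auto simp: sphp_def)
    with 1 show ?thesis by simp
  next
    case (2 j)
    with True have "j \<le> k" and C: "x \<in> Qpn_carrier p" by (auto simp: ballp_def)
    have iff: "x \<in> sphp p (k - int i) \<longleftrightarrow> i = nat (k - j)" for i
      using C 2 \<open>j \<le> k\<close> by (auto simp: sphp_def simp del: of_int_diff)
    have "(\<Sum>i. ppow ((real_of_int k - real i) * a) * indicator (sphp p (k - int i)) x) =
       (\<Sum>i\<in>{nat (k - j)}. ppow ((real_of_int k - real i) * a) * indicator (sphp p (k - int i)) x)"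
      by (rule suminf_finite) (auto simp: iff)
    also have "\<dots> = ppow (real_of_int j * a)"
      using \<open>j \<le> k\<close> iff[of "nat (k - j)"] by simp
    finally show ?thesis
      using True 2 by (simp add: ppow_def powr_powr)
  qed
qed

lemma measurable_weight_on_ball [measurable]:
  "(\<lambda>x. ennreal (qpn_norm p x powr a) * indicator (ballp p k) x) \<in> borel_measurable (haar p)"
  unfolding weight_on_ball by measurable

lemma wmeas_ball:
  "wmeas p (\<lambda>x. qpn_norm p x powr a) (ballp p k :: 'n::finite qpn set) =
    ppow (real_of_int k * (real CARD('n) + a)) * w0 TYPE('n) a"
proof -
  have "wmeas p (\<lambda>x. qpn_norm p x powr a) (ballp p k :: 'n qpn set) =
    (\<Sum>i. ppow ((real_of_int k - real i) * a) * emeasure (haar p) (sphp p (k - int i) :: 'n qpn set))"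
    unfolding wmeas_def weight_on_ball by (simp add: nn_integral_suminf nn_integral_cmult)
  also have "\<dots> = (\<Sum>i. ppow (real_of_int k * (real CARD('n) + a)) * s0 TYPE('n) * ppow (- (real i * (real CARD('n) + a))))"
  proof (rule suminf_cong)
    fix i
    have "ppow ((real_of_int k - real i) * a) * ppow (real_of_int (k - int i) * real CARD('n)) =
      ppow (real_of_int k * (real CARD('n) + a)) * ppow (- (real i * (real CARD('n) + a)))"
      by (simp add: algebra_simps flip: ppow_add)
    then show "ppow ((real_of_int k - real i) * a) * emeasure (haar p) (sphp p (k - int i) :: 'n qpn set) =
      ppow (real_of_int k * (real CARD('n) + a)) * s0 TYPE('n) * ppow (- (real i * (real CARD('n) + a)))"
      by (simp add: emeasure_sphp mult_ac)
  qed
  also have "\<dots> = ppow (real_of_int k * (real CARD('n) + a)) * w0 TYPE('n) a"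
    by (simp add: ennreal_suminf_cmult w0_def mult.assoc)
  finally show ?thesis .
qed

subsection \<open>Norms over spheres and balls\<close>

lemma epowr_ppow: "epowr (ppow t) r = ppow (t * r)"
  by (simp add: ppow_def epowr_ennreal powr_powr)

lemma ppow_sum: "finite I \<Longrightarrow> ppow (sum g I) = (\<Prod>i\<in>I. ppow (g i))"
  by (induction I rule: finite_induct) (simp_all add: ppow_add)

text \<open>A density instead of a restricted space: the underlying space and the sigma-algebra
  remain those of \<open>haar p\<close>, so one measurability fact serves all spheres.\<close>

definition sph_meas :: "int \<Rightarrow> 'n::finite qpn measure" where
  "sph_meas k = density (haar p) (indicator (sphp p k))"

lemma space_sph_meas [simp]: "space (sph_meas k) = UNIV"
  by (simp add: sph_meas_def)

lemma sets_sph_meas [simp, measurable_cong]: "sets (sph_meas k) = sets (haar p)"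
  by (simp add: sph_meas_def)

lemma nn_integral_sph_meas:
  "g \<in> borel_measurable (haar p) \<Longrightarrow> (\<integral>\<^sup>+x. g x \<partial>sph_meas k) = (\<integral>\<^sup>+x\<in>sphp p k. g x \<partial>haar p)"
  unfolding sph_meas_def by (subst nn_integral_density) (auto simp: mult.commute)

lemma emeasure_sph_meas [simp]:
  "emeasure (sph_meas k :: 'n::finite qpn measure) UNIV = ppow (real_of_int k * real CARD('n)) * s0 TYPE('n)"
  using emeasure_density[of "indicator (sphp p k)" "haar p :: 'n qpn measure" UNIV]
  by (simp add: sph_meas_def emeasure_sphp flip: space_haar)

lemma sigma_finite_sph_meas: "sigma_finite_measure (sph_meas k :: 'n::finite qpn measure)"
proof -
  interpret finite_measure "sph_meas k :: 'n qpn measure"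
    by standard (simp add: ennreal_mult_eq_top_iff)
  show ?thesis by (rule sigma_finite_measure_axioms)
qed

text \<open>Unlike \<open>sph_meas\<close> this includes the weight, which is not constant on a
  ball; the weighted average is the plain mean for this measure.\<close>

definition ball_meas :: "real \<Rightarrow> int \<Rightarrow> 'n::finite qpn measure" where
  "ball_meas a k = density (haar p) (\<lambda>x. ennreal (qpn_norm p x powr a * indicator (ballp p k) x))"

lemma space_ball_meas [simp]: "space (ball_meas a k) = UNIV"
  by (simp add: ball_meas_def)

lemma sets_ball_meas [simp, measurable_cong]: "sets (ball_meas a k) = sets (haar p)"
  by (simp add: ball_meas_def)

lemma measurable_real_weight_on_ball [measurable]:
  "(\<lambda>x. qpn_norm p x powr a * indicator (ballp p k) x) \<in> borel_measurable (haar p)"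
proof -
  have "(\<lambda>x. enn2real (ennreal (qpn_norm p x powr a) * indicator (ballp p k) x)) \<in> borel_measurable (haar p)"
    by (intro borel_measurable_enn2real measurable_weight_on_ball)
  also have "(\<lambda>x. enn2real (ennreal (qpn_norm p x powr a) * indicator (ballp p k) x))
     = (\<lambda>x. qpn_norm p x powr a * indicator (ballp p k) x)"
    by (auto simp: fun_eq_iff split: split_indicator)
  finally show ?thesis .
qed

lemma nn_integral_ball_meas:
  assumes [measurable]: "g \<in> borel_measurable (haar p)"
  shows "(\<integral>\<^sup>+x. g x \<partial>ball_meas a k) = (\<integral>\<^sup>+x\<in>ballp p k. g x * ennreal (qpn_norm p x powr a) \<partial>haar p)"
proof -
  have "(\<lambda>x. ennreal (qpn_norm p x powr a * indicator (ballp p k) x)) \<in> borel_measurable (haar p)"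
    by measurable
  then show ?thesis
    unfolding ball_meas_def
    by (subst nn_integral_density) (auto intro!: nn_integral_cong split: split_indicator simp: mult.commute)
qed

lemma emeasure_ball_meas [simp]:
  "emeasure (ball_meas a k :: 'n::finite qpn measure) UNIV =
    ppow (real_of_int k * (real CARD('n) + a)) * w0 TYPE('n) a"
proof -
  have "emeasure (ball_meas a k :: 'n::finite qpn measure) UNIV = (\<integral>\<^sup>+x. 1 \<partial>(ball_meas a k :: 'n qpn measure))"
    by simp
  also have "\<dots> = wmeas p (\<lambda>x. qpn_norm p x powr a) (ballp p k :: 'n qpn set)"
    unfolding wmeas_def by (subst nn_integral_ball_meas) auto
  finally show ?thesis by (simp add: wmeas_ball)
qed

lemma weight_on_sphere: "x \<in> sphp p k \<Longrightarrow> ennreal (qpn_norm p x powr a) = ppow (real_of_int k * a)"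
  by (simp add: sphp_def ppow_def powr_powr)

text \<open>Only the majorant \<open>G\<close> has to be measurable. This is the form needed for the
  commutator, whose own measurability is not established.\<close>

lemma wLnorm_sphere_le:
  assumes s: "s > 0" and [measurable]: "G \<in> borel_measurable (haar p)"
    and le: "\<And>x. x \<in> sphp p k \<Longrightarrow> ennreal (norm (f x)) \<le> G x"
  shows "wLnorm p s (\<lambda>x. qpn_norm p x powr a) (sphp p k) f \<le> ppow (real_of_int k * a / s) * eLp (sph_meas k) s G"
proof -
  have "(\<integral>\<^sup>+x\<in>sphp p k. ennreal (norm (f x) powr s * qpn_norm p x powr a) \<partial>haar p)
    \<le> (\<integral>\<^sup>+x. ppow (real_of_int k * a) * (epowr (G x) s * indicator (sphp p k) x) \<partial>haar p)"
  proof (rule nn_integral_mono)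
    fix x
    show "ennreal (norm (f x) powr s * qpn_norm p x powr a) * indicator (sphp p k) x
      \<le> ppow (real_of_int k * a) * (epowr (G x) s * indicator (sphp p k) x)"
    proof (cases "x \<in> sphp p k")
      case True
      have "epowr (ennreal (norm (f x))) s \<le> epowr (G x) s"
        using s le[OF True] by (intro epowr_mono) auto
      then show ?thesis
        using True by (simp add: ennreal_mult weight_on_sphere epowr_ennreal mult.commute[of "ppow _"] mult_right_mono)
    qed simp
  qed
  also have "\<dots> = ppow (real_of_int k * a) * epowr (eLp (sph_meas k) s G) s"
    using s by (simp add: epowr_eLp nn_integral_sph_meas nn_integral_cmult)
  finally have "wLnorm p s (\<lambda>x. qpn_norm p x powr a) (sphp p k) f \<le> epowr \<dots> (1 / s)"
    unfolding wLnorm_def using s by (intro epowr_mono) auto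
  then show ?thesis
    using s by (simp add: epowr_mult epowr_ppow epowr_epowr)
qed

lemma wLnorm_sphere:
  assumes s: "s > 0" and [measurable]: "f \<in> borel_measurable (haar p)"
  shows "wLnorm p s (\<lambda>x. qpn_norm p x powr a) (sphp p k) f =
    ppow (real_of_int k * a / s) * eLp (sph_meas k) s (\<lambda>x. ennreal (norm (f x)))"
proof -
  have "(\<integral>\<^sup>+x\<in>sphp p k. ennreal (norm (f x) powr s * qpn_norm p x powr a) \<partial>haar p)
    = (\<integral>\<^sup>+x. ppow (real_of_int k * a) * (epowr (ennreal (norm (f x))) s * indicator (sphp p k) x) \<partial>haar p)"
    by (intro nn_integral_cong)
      (auto split: split_indicator simp: ennreal_mult weight_on_sphere epowr_ennreal mult.commute)
  also have "\<dots> = ppow (real_of_int k * a) * epowr (eLp (sph_meas k) s (\<lambda>x. ennreal (norm (f x)))) s"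
    using s by (simp add: epowr_eLp nn_integral_sph_meas nn_integral_cmult)
  finally show ?thesis
    using s by (simp add: wLnorm_def epowr_mult epowr_ppow epowr_epowr)
qed

text \<open>S_k is contained in B_k, and the weight has the constant value p^(ka) on S_k.\<close>

lemma eLp_sphere_le_ball:
  assumes s: "s > 0" and [measurable]: "G \<in> borel_measurable (haar p)"
  shows "eLp (sph_meas k) s G \<le> ppow (- (real_of_int k * a / s)) * eLp (ball_meas a k) s G"
proof -
  have "(\<integral>\<^sup>+x. epowr (G x) s \<partial>sph_meas k) = (\<integral>\<^sup>+x. epowr (G x) s * indicator (sphp p k) x \<partial>haar p)"
    by (simp add: nn_integral_sph_meas)
  also have "\<dots> \<le> (\<integral>\<^sup>+x. ppow (- (real_of_int k * a)) *
      (epowr (G x) s * ennreal (qpn_norm p x powr a) * indicator (ballp p k) x) \<partial>haar p)"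
  proof (rule nn_integral_mono)
    fix x
    show "epowr (G x) s * indicator (sphp p k) x \<le> ppow (- (real_of_int k * a)) *
      (epowr (G x) s * ennreal (qpn_norm p x powr a) * indicator (ballp p k) x)"
    proof (cases "x \<in> sphp p k")
      case True
      have "ppow (- (real_of_int k * a)) * (epowr (G x) s * ppow (real_of_int k * a)) =
        epowr (G x) s * (ppow (- (real_of_int k * a)) * ppow (real_of_int k * a))"
        by (simp only: mult_ac)
      also have "\<dots> = epowr (G x) s" by (simp flip: ppow_add)
      finally show ?thesis
        using True by (simp add: weight_on_sphere sphp_eq)
    qed simp
  qed
  also have "\<dots> = ppow (- (real_of_int k * a)) * (\<integral>\<^sup>+x. epowr (G x) s \<partial>ball_meas a k)"
    by (subst nn_integral_cmult) (auto simp: nn_integral_ball_meas mult.assoc)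
  finally have "eLp (sph_meas k) s G \<le> epowr \<dots> (1 / s)"
    unfolding eLp_def using s by (intro epowr_mono) auto
  then show ?thesis using s by (simp add: eLp_def epowr_mult epowr_ppow)
qed

lemma eLp_unit_sphere_scale:
  fixes G :: "'n::finite qpn \<Rightarrow> ennreal"
  assumes s: "s > 0" and [measurable]: "G \<in> borel_measurable (haar p)"
  shows "eLp (sph_meas 0) s (\<lambda>y. G (qpn_ppow_scale j y)) =
    ppow (real_of_int j * real CARD('n) / s) * eLp (sph_meas (- j)) s G"
  using s nn_integral_unit_sphere_scale[of "\<lambda>x. epowr (G x) s" j]
  by (simp add: eLp_def nn_integral_sph_meas epowr_mult epowr_ppow)

subsection \<open>Mean oscillation\<close>

context
  fixes r a :: real and b :: "'n::finite qpn \<Rightarrow> complex"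
  assumes r: "r \<ge> 1" and a: "a > - real CARD('n)"
    and b: "b \<in> CMO_space p r (\<lambda>x. qpn_norm p x powr a)"
begin

abbreviation avg where "avg k \<equiv> wavg p (\<lambda>x. qpn_norm p x powr a) (ballp p k) b"
abbreviation bnorm where "bnorm \<equiv> CMO_norm p r (\<lambda>x. qpn_norm p x powr a) b"

lemma measurable_CMO [measurable]: "b \<in> borel_measurable (haar p)"
  using b by (simp add: CMO_space_def)

lemma w0_finite [simp]: "w0 TYPE('n) a \<noteq> \<top>"
  by (rule w0_neq_top) (rule a)

text \<open>The k-th term of the supremum in \<open>CMO_norm\<close>, with the division by the
  weighted mass undone; the mass is neither 0 nor \<top>.\<close>

lemma oscillation_ball:
  "eLp (ball_meas a k) r (\<lambda>x. ennreal (norm (b x - avg k))) \<le>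
    ppow (real_of_int k * (real CARD('n) + a) / r) * epowr (w0 TYPE('n) a) (1 / r) * bnorm"
proof -
  define W where "W = wmeas p (\<lambda>x. qpn_norm p x powr a) (ballp p k :: 'n qpn set)"
  have W: "W \<noteq> 0" "W \<noteq> \<top>"
    by (simp_all add: W_def wmeas_ball ennreal_mult_eq_top_iff)
  define I where "I = (\<integral>\<^sup>+ x\<in>ballp p k. ennreal (norm (b x - avg k) powr r * qpn_norm p x powr a) \<partial>haar p)"
  have "epowr (I / W) (1 / r) \<le> bnorm"
    unfolding CMO_norm_def I_def W_def by (rule SUP_upper) simp
  then have "epowr W (1 / r) * epowr (I / W) (1 / r) \<le> epowr W (1 / r) * bnorm"
    by (rule mult_left_mono) simp
  moreover have "epowr W (1 / r) * epowr (I / W) (1 / r) = epowr I (1 / r)"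
  proof -
    have "W * (I / W) = I"
      unfolding ennreal_times_divide mult.commute[of W] by (rule ennreal_mult_divide_eq[OF W])
    with r epowr_mult[of "1 / r" W "I / W"] show ?thesis by simp
  qed
  moreover have "I = (\<integral>\<^sup>+x. epowr (ennreal (norm (b x - avg k))) r \<partial>ball_meas a k)"
    unfolding I_def by (subst nn_integral_ball_meas) (auto simp: epowr_ennreal ennreal_mult)
  moreover have "epowr W (1 / r) = ppow (real_of_int k * (real CARD('n) + a) / r) * epowr (w0 TYPE('n) a) (1 / r)"
    using r by (simp add: W_def wmeas_ball epowr_mult epowr_ppow)
  ultimately show ?thesis by (simp add: eLp_def)
qed

lemma oscillation_ball_1:
  "(\<integral>\<^sup>+x. ennreal (norm (b x - avg k)) \<partial>ball_meas a k) \<le>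
    ppow (real_of_int k * (real CARD('n) + a)) * w0 TYPE('n) a * bnorm"
proof -
  define V where "V = ppow (real_of_int k * (real CARD('n) + a)) * w0 TYPE('n) a"
  have "(\<integral>\<^sup>+x. ennreal (norm (b x - avg k)) \<partial>ball_meas a k) \<le>
     eLp (ball_meas a k) r (\<lambda>x. ennreal (norm (b x - avg k))) * epowr V (1 - 1 / r)"
    unfolding V_def
    using nn_integral_le_eLp[OF r, of "\<lambda>x. ennreal (norm (b x - avg k))" "ball_meas a k"]
    by (simp add: ennreal_mult_eq_top_iff)
  also have "\<dots> \<le> (epowr V (1 / r) * bnorm) * epowr V (1 - 1 / r)"
    using oscillation_ball[of k] r by (intro mult_right_mono) (simp_all add: V_def epowr_mult epowr_ppow)
  also have "\<dots> = epowr V (1 / r + (1 - 1 / r)) * bnorm"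
    unfolding epowr_add by (simp only: mult_ac)
  finally show ?thesis by (simp add: V_def)
qed

text \<open>A local L^r function is integrable on a ball of finite weighted mass. Without this the
  Bochner integral in \<open>wavg\<close> would be a default value and not linear.\<close>

lemma integrable_ball_meas: "integrable (ball_meas a k) b"
proof (rule integrableI_bounded)
  have "(\<integral>\<^sup>+ x\<in>ballp p k. ennreal (norm (b x) powr r * qpn_norm p x powr a) \<partial>haar p) < \<top>"
    using b by (simp add: CMO_space_def)
  also have "(\<integral>\<^sup>+ x\<in>ballp p k. ennreal (norm (b x) powr r * qpn_norm p x powr a) \<partial>haar p) =
     (\<integral>\<^sup>+x. epowr (ennreal (norm (b x))) r \<partial>ball_meas a k)"
    by (subst nn_integral_ball_meas) (auto simp: epowr_ennreal ennreal_mult)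
  finally have "eLp (ball_meas a k) r (\<lambda>x. ennreal (norm (b x))) \<noteq> \<top>"
    by (simp add: eLp_def less_top)
  moreover have "(\<integral>\<^sup>+x. ennreal (norm (b x)) \<partial>ball_meas a k) \<le> eLp (ball_meas a k) r (\<lambda>x. ennreal (norm (b x)))
     * epowr (emeasure (ball_meas a k :: 'n qpn measure) (space (ball_meas a k))) (1 - 1 / r)"
    by (rule nn_integral_le_eLp) (use r in \<open>auto simp: ennreal_mult_eq_top_iff\<close>)
  moreover have "epowr (emeasure (ball_meas a k :: 'n qpn measure) (space (ball_meas a k))) (1 - 1 / r) \<noteq> \<top>"
    by (simp add: ennreal_mult_eq_top_iff)
  ultimately have "(\<integral>\<^sup>+x. ennreal (norm (b x)) \<partial>ball_meas a k) \<noteq> \<top>"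
    by (metis ennreal_mult_eq_top_iff neq_top_trans)
  then show "(\<integral>\<^sup>+x. ennreal (norm (b x)) \<partial>ball_meas a k) < \<infinity>"
    by (simp add: less_top)
qed simp

lemma avg_eq: "avg k = (1 / measure (ball_meas a k :: 'n qpn measure) UNIV) *\<^sub>R integral\<^sup>L (ball_meas a k) b"
proof -
  have "integral\<^sup>L (ball_meas a k) b = (LINT x:ballp p k|haar p. complex_of_real (qpn_norm p x powr a) * b x)"
    unfolding ball_meas_def set_lebesgue_integral_def
    by (subst integral_density) (auto intro!: Bochner_Integration.integral_cong split: split_indicator simp: scaleR_conv_of_real)
  moreover have "measure (ball_meas a k :: 'n qpn measure) UNIV = enn2real (wmeas p (\<lambda>x. qpn_norm p x powr a) (ballp p k :: 'n qpn set))"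
    by (simp add: measure_def wmeas_ball)
  ultimately show ?thesis
    by (simp add: wavg_def scaleR_conv_of_real)
qed

text \<open>The difference is the mean of b - \<open>avg k\<close> over the smaller ball. Enlarging
  the domain to the larger ball and using its L^1 oscillation costs the quotient of the two masses,
  \<open>V k\<close> over \<open>V l\<close>; no chain of intermediate balls is required.\<close>

lemma avg_diff_le:
  assumes "l \<le> k"
  shows "ennreal (norm (avg l - avg k)) \<le> ppow (real_of_int (k - l) * (real CARD('n) + a)) * bnorm"
proof -
  let ?B = "ball_meas a l :: 'n qpn measure"
  define V where "V l = ppow (real_of_int l * (real CARD('n) + a)) * w0 TYPE('n) a" for l
  have V: "V l \<noteq> 0" "V l \<noteq> \<top>" by (simp_all add: V_def ennreal_mult_eq_top_iff)
  interpret finite_measure ?B by standard (simp add: ennreal_mult_eq_top_iff)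
  define c where "c = avg k"
  have EV: "ennreal (measure ?B UNIV) = V l"
    using emeasure_eq_measure[of UNIV] by (simp add: V_def)
  then have mpos: "measure ?B UNIV > 0"
    using V by (metis ennreal_0 less_eq_real_def measure_nonneg)
  have "integral\<^sup>L ?B (\<lambda>x. b x - c) = integral\<^sup>L ?B b - measure ?B UNIV *\<^sub>R c"
    by (subst Bochner_Integration.integral_diff[OF integrable_ball_meas]) auto
  then have "avg l - c = (1 / measure ?B UNIV) *\<^sub>R integral\<^sup>L ?B (\<lambda>x. b x - c)"
    using mpos by (simp add: avg_eq[of l] scaleR_diff_right)
  then have "measure ?B UNIV * norm (avg l - c) = norm (integral\<^sup>L ?B (\<lambda>x. b x - c))"
    using mpos by simp
  then have "V l * ennreal (norm (avg l - c)) = ennreal (norm (integral\<^sup>L ?B (\<lambda>x. b x - c)))"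
    unfolding EV[symmetric] by (simp add: ennreal_mult[symmetric])
  also have "\<dots> \<le> (\<integral>\<^sup>+x. ennreal (norm (b x - c)) \<partial>?B)"
    by (intro integral_norm_bound_ennreal Bochner_Integration.integrable_diff integrable_ball_meas) simp
  also have "\<dots> \<le> (\<integral>\<^sup>+x. ennreal (norm (b x - c)) \<partial>ball_meas a k)"
    using ballp_mono[OF assms] by (auto simp: nn_integral_ball_meas intro!: nn_integral_mono split: split_indicator)
  also have "\<dots> \<le> V k * bnorm"
    unfolding c_def V_def by (rule oscillation_ball_1)
  also have "V k = V l * ppow (real_of_int (k - l) * (real CARD('n) + a))"
    by (simp add: V_def mult.assoc mult.commute[of "w0 _ _"]) (simp add: mult.assoc[symmetric] algebra_simps flip: ppow_add)
  finally have "V l * ennreal (norm (avg l - c)) \<le> V l * (ppow (real_of_int (k - l) * (real CARD('n) + a)) * bnorm)"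
    by (simp add: mult.assoc)
  then show ?thesis
    using V by (simp add: c_def ennreal_mult_le_mult_iff)
qed

lemma avg_diff_le_abs:
  "ennreal (norm (avg k - avg (k - g))) \<le> ppow (real_of_int \<bar>g\<bar> * (a + real CARD('n))) * bnorm"
proof (cases "g \<ge> 0")
  case True
  then show ?thesis
    using avg_diff_le[of "k - g" k] by (simp add: norm_minus_commute add.commute)
next
  case False
  then show ?thesis
    using avg_diff_le[of k "k - g"] by (simp add: add.commute)
qed

text \<open>Removing the weight on S_k cancels its share a in the exponent n + a of the mass of
  B_k.\<close>

lemma oscillation_sphere:
  "eLp (sph_meas k) r (\<lambda>x. ennreal (norm (b x - avg k))) \<le>
    ppow (real_of_int k * real CARD('n) / r) * epowr (w0 TYPE('n) a) (1 / r) * bnorm"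
proof -
  have "eLp (sph_meas k) r (\<lambda>x. ennreal (norm (b x - avg k))) \<le>
    ppow (- (real_of_int k * a / r)) * eLp (ball_meas a k) r (\<lambda>x. ennreal (norm (b x - avg k)))"
    using r by (intro eLp_sphere_le_ball) auto
  also have "\<dots> \<le> ppow (- (real_of_int k * a / r)) * (ppow (real_of_int k * (real CARD('n) + a) / r) * epowr (w0 TYPE('n) a) (1 / r) * bnorm)"
    by (intro mult_left_mono oscillation_ball) simp
  also have "\<dots> = ppow (- (real_of_int k * a / r) + real_of_int k * (real CARD('n) + a) / r) * epowr (w0 TYPE('n) a) (1 / r) * bnorm"
    by (simp only: ppow_add mult.assoc)
  also have "- (real_of_int k * a / r) + real_of_int k * (real CARD('n) + a) / r = real_of_int k * real CARD('n) / r"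
    using r by (simp add: field_simps)
  finally show ?thesis .
qed

text \<open>Each of the three terms from the triangle inequality depends on at most one of the two
  variables, so every idle variable contributes only the mass of its sphere. In the abbreviations
  below, \<open>X\<close> and \<open>Q\<close> come from these masses and \<open>Y\<close> from the
  weighted mass of the unit ball.\<close>

lemma eLp_commutator_factor:
  "eLp (sph_meas k \<Otimes>\<^sub>M sph_meas 0) r (\<lambda>z. ennreal (norm (b (fst z) - b (qpn_ppow_scale (g - k) (snd z))))) \<le>
    epowr (s0 TYPE('n) * w0 TYPE('n) a) (1 / r) * ppow (real_of_int k * real CARD('n) / r) *
    (2 + ppow (real_of_int \<bar>g\<bar> * (a + real CARD('n)))) * bnorm" (is "eLp ?M r ?F \<le> _")
proof -
  have rpos: "r > 0" using r by simp
  define X where "X = epowr (s0 TYPE('n)) (1 / r)"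
  define Y where "Y = epowr (w0 TYPE('n) a) (1 / r)"
  define Q where "Q = ppow (real_of_int k * real CARD('n) / r)"
  define E where "E = ppow (real_of_int \<bar>g\<bar> * (a + real CARD('n)))"
  let ?F1 = "\<lambda>z. ennreal (norm (b (fst z) - avg k))"
  let ?F2 = "\<lambda>z::'n qpn \<times> 'n qpn. ennreal (norm (avg k - avg (k - g)))"
  let ?G = "\<lambda>y. ennreal (norm (b y - avg (k - g)))"
  let ?F3 = "\<lambda>z. ?G (qpn_ppow_scale (g - k) (snd z))"
  note sf = sigma_finite_sph_meas[of 0, where 'n='n]
  have "eLp ?M r ?F \<le> eLp ?M r (\<lambda>z. ?F1 z + (?F2 z + ?F3 z))"
  proof (rule eLp_mono[OF rpos])
    fix z :: "'n qpn \<times> 'n qpn"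
    have "norm (u - v) \<le> norm (u - s) + (norm (s - t) + norm (v - t))" for u v s t :: complex
    proof -
      have "norm (u - v) = norm ((u - s) + ((s - t) - (v - t)))" by (rule arg_cong[of _ _ norm]) simp
      also have "\<dots> \<le> norm (u - s) + norm ((s - t) - (v - t))" by (rule norm_triangle_ineq)
      also have "\<dots> \<le> norm (u - s) + (norm (s - t) + norm (v - t))" by (intro add_left_mono norm_triangle_ineq4)
      finally show ?thesis .
    qed
    then show "?F z \<le> ?F1 z + (?F2 z + ?F3 z)"
      by (simp add: ennreal_plus[symmetric] del: ennreal_plus)
  qed
  also have "\<dots> \<le> eLp ?M r ?F1 + eLp ?M r (\<lambda>z. ?F2 z + ?F3 z)"
    by (intro eLp_add_le r) measurable
  finally have main: "eLp ?M r ?F \<le> eLp ?M r ?F1 + eLp ?M r (\<lambda>z. ?F2 z + ?F3 z)" .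
  have t0: "eLp ?M r (\<lambda>z. ?F2 z + ?F3 z) \<le> eLp ?M r ?F2 + eLp ?M r ?F3"
    by (intro eLp_add_le r) measurable
  have t1: "eLp ?M r ?F1 \<le> X * Q * Y * bnorm"
  proof -
    have "eLp ?M r ?F1 = X * eLp (sph_meas k) r (\<lambda>x. ennreal (norm (b x - avg k)))"
      using rpos by (subst eLp_pair_fst[OF sf]) (auto simp: X_def)
    also have "\<dots> \<le> X * (Q * Y * bnorm)"
      unfolding Q_def Y_def by (intro mult_left_mono oscillation_sphere) simp
    finally show ?thesis by (simp only: mult.assoc)
  qed
  have t2: "eLp ?M r ?F2 \<le> X * Q * Y * bnorm * E"
  proof -
    have "eLp ?M r ?F2 = ennreal (norm (avg k - avg (k - g))) * (Q * X * X)"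
      using rpos eLp_pair_fst[OF sf rpos, of "\<lambda>_. ennreal (norm (avg k - avg (k - g)))" "sph_meas k"]
      by (simp add: eLp_const X_def Q_def epowr_mult epowr_ppow mult_ac)
    also have "\<dots> \<le> (E * bnorm) * (Q * X * Y)"
    proof (intro mult_mono)
      \<comment> \<open>The constant term produces \<open>X\<close> twice where the oscillations
        produce \<open>X\<close> and \<open>Y\<close>; since S_0 lies in B_0 and has weight 1, all
        three can share the constant \<open>X\<close> times \<open>Y\<close>.\<close>
      show "X \<le> Y" unfolding X_def Y_def using rpos by (intro epowr_mono s0_le_w0) simp
    qed (use avg_diff_le_abs[of k g] in \<open>auto simp: E_def\<close>)
    finally show ?thesis by (simp only: mult_ac)
  qed
  have t3: "eLp ?M r ?F3 \<le> X * Q * Y * bnorm"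
  proof -
    have "eLp ?M r ?F3 = Q * X * eLp (sph_meas 0) r (\<lambda>y. ?G (qpn_ppow_scale (g - k) y))"
      using rpos by (subst eLp_pair_snd[OF sf]) (auto simp: X_def Q_def epowr_mult epowr_ppow)
    also have "\<dots> = Q * X * (ppow (real_of_int (g - k) * real CARD('n) / r) * eLp (sph_meas (k - g)) r ?G)"
      using rpos by (subst eLp_unit_sphere_scale) auto
    also have "\<dots> \<le> Q * X * (ppow (real_of_int (g - k) * real CARD('n) / r) *
        (ppow (real_of_int (k - g) * real CARD('n) / r) * Y * bnorm))"
      unfolding Y_def by (intro mult_left_mono oscillation_sphere) simp_all
    also have "\<dots> = Q * X * (ppow (real_of_int (g - k) * real CARD('n) / r + real_of_int (k - g) * real CARD('n) / r) * Y * bnorm)"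
      by (simp only: ppow_add mult.assoc)
    \<comment> \<open>The Jacobian of the dilation from S_0 to S_(k-g) cancels the size of that
      sphere in the oscillation bound.\<close>
    also have "real_of_int (g - k) * real CARD('n) / r + real_of_int (k - g) * real CARD('n) / r = 0"
    proof -
      have "real_of_int (g - k) = - real_of_int (k - g)" by simp
      then show ?thesis by (simp only: mult_minus_left minus_divide_left[symmetric] left_minus)
    qed
    finally show ?thesis by (simp add: mult_ac)
  qed
  have "eLp ?M r ?F \<le> X * Q * Y * bnorm + (X * Q * Y * bnorm * E + X * Q * Y * bnorm)"
    by (rule order_trans[OF main add_mono[OF t1 order_trans[OF t0 add_mono[OF t2 t3]]]])
  also have "\<dots> = X * Y * Q * (2 + E) * bnorm"
  proof -
    have "Z + (Z * E + Z) = Z * (2 + E)" for Z :: ennreal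
      by (simp add: distrib_left mult_2_right add_ac)
    from this[of "X * Q * Y * bnorm"] show ?thesis by (simp only: mult_ac)
  qed
  finally show ?thesis
    using rpos by (simp add: X_def Y_def Q_def E_def epowr_mult)
qed

end

text \<open>Three powers of p meet here: the mass of S_k for the idle variable x, the Jacobian of
  the dilation of S_0 onto S_(k-g), and the constant weight on S_(k-g).\<close>

lemma eLp_scaled_factor:
  fixes f :: "'n::finite qpn \<Rightarrow> complex"
  assumes s: "s > 0" and [measurable]: "f \<in> borel_measurable (haar p)"
  shows "eLp ((sph_meas k :: 'n qpn measure) \<Otimes>\<^sub>M sph_meas 0) s (\<lambda>z. ennreal (norm (f (qpn_ppow_scale (g - k) (snd z))))) =
    epowr (s0 TYPE('n)) (1 / s) * ppow (real_of_int k * real CARD('n) / s + real_of_int (g - k) * (real CARD('n) + a) / s) *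
    wLnorm p s (\<lambda>x. qpn_norm p x powr a) (sphp p (k - g)) f"
proof -
  let ?G = "\<lambda>y. ennreal (norm (f y))"
  let ?e = "eLp (sph_meas (k - g)) s ?G"
  have "eLp ((sph_meas k :: 'n qpn measure) \<Otimes>\<^sub>M sph_meas 0) s (\<lambda>z. ?G (qpn_ppow_scale (g - k) (snd z)))
      = epowr (s0 TYPE('n)) (1 / s) * (ppow (real_of_int k * real CARD('n) / s) * ppow (real_of_int (g - k) * real CARD('n) / s)) * ?e"
  proof -
    have "eLp (sph_meas 0) s (\<lambda>y. ?G (qpn_ppow_scale (g - k) y)) = ppow (real_of_int (g - k) * real CARD('n) / s) * ?e"
      using s eLp_unit_sphere_scale[of s ?G "g - k"] by simp
    moreover have "eLp ((sph_meas k :: 'n qpn measure) \<Otimes>\<^sub>M sph_meas 0) s (\<lambda>z. ?G (qpn_ppow_scale (g - k) (snd z)))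
      = epowr (emeasure (sph_meas k :: 'n qpn measure) UNIV) (1 / s) * eLp (sph_meas 0) s (\<lambda>y. ?G (qpn_ppow_scale (g - k) y))"
      using s by (subst eLp_pair_snd[OF sigma_finite_sph_meas]) simp_all
    ultimately show ?thesis
      using s by (simp only: emeasure_sph_meas epowr_mult epowr_ppow zero_less_divide_1_iff) (simp add: mult_ac)
  qed
  \<comment> \<open>The power p^((k-g)a/s) is split off because it turns the unweighted norm on
    S_(k-g) into the weighted one.\<close>
  also have "ppow (real_of_int k * real CARD('n) / s) * ppow (real_of_int (g - k) * real CARD('n) / s) =
    ppow (real_of_int k * real CARD('n) / s + real_of_int (g - k) * (real CARD('n) + a) / s) * ppow (real_of_int (k - g) * a / s)"
    using s unfolding ppow_add[symmetric] by (intro arg_cong[of _ _ ppow]) (simp add: field_simps)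
  finally show ?thesis
    using s by (simp add: wLnorm_sphere mult.assoc)
qed

subsection \<open>The commutator\<close>

text \<open>\<Omega> is measurable only on S_0; extension by 0 makes its modulus measurable for
  \<open>haar p\<close>.\<close>

definition restr_norm :: "('n::finite qpn \<Rightarrow> complex) \<Rightarrow> 'n qpn \<Rightarrow> ennreal" where
  "restr_norm \<Omega> y = ennreal (norm (indicator (sphp p 0) y *\<^sub>R \<Omega> y))"

lemma restr_norm_sphere: "y \<in> sphp p 0 \<Longrightarrow> restr_norm \<Omega> y = ennreal (norm (\<Omega> y))"
  by (simp add: restr_norm_def)

lemma measurable_restr_norm:
  assumes "\<Omega> \<in> borel_measurable (restrict_space (haar p) (sphp p 0))"
  shows "restr_norm \<Omega> \<in> borel_measurable (haar p)"
proof -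
  have "(\<lambda>y. indicator (sphp p 0) y *\<^sub>R \<Omega> y) \<in> borel_measurable (haar p)"
    using assms by (subst (asm) borel_measurable_restrict_space_iff) auto
  then show ?thesis unfolding restr_norm_def[abs_def] by measurable
qed

text \<open>The factor \<open>G\<close> receives the exponent q itself, so that the result can be
  merged with the L^q norm in x. For q = 1 the norm of \<Omega> is an essential supremum and is
  handled as a pointwise bound.\<close>

lemma Holder_unit_sphere:
  fixes \<Omega> :: "'n::finite qpn \<Rightarrow> complex"
  assumes q: "q \<ge> 1" and \<Omega>: "\<Omega> \<in> borel_measurable (restrict_space (haar p) (sphp p 0))"
    and [measurable]: "G \<in> borel_measurable (haar p)"
  shows "(\<integral>\<^sup>+y. restr_norm \<Omega> y * G y \<partial>sph_meas 0) \<le> Lconj_norm_S0 p q \<Omega> * eLp (sph_meas 0) q G"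
proof -
  note [measurable] = measurable_restr_norm[OF \<Omega>]
  show ?thesis
  proof (cases "q = 1")
    case True
    define c where "c = Lconj_norm_S0 p q \<Omega>"
    have "AE y in haar p. y \<in> sphp p 0 \<longrightarrow> ennreal (norm (\<Omega> y)) \<le> c"
      unfolding c_def Lconj_norm_S0_def using True by (auto intro: AE_le_Inf)
    then have "(\<integral>\<^sup>+y. restr_norm \<Omega> y * G y * indicator (sphp p 0) y \<partial>haar p)
        \<le> (\<integral>\<^sup>+y. c * (G y * indicator (sphp p 0) y) \<partial>haar p)"
      by (intro nn_integral_mono_AE) (auto elim!: eventually_mono split: split_indicator simp: restr_norm_sphere intro: mult_right_mono)
    also have "\<dots> = c * eLp (sph_meas 0) q G"
      using True by (subst nn_integral_cmult) (auto simp: eLp_1 nn_integral_sph_meas)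
    also have "(\<integral>\<^sup>+y. restr_norm \<Omega> y * G y * indicator (sphp p 0) y \<partial>haar p) = (\<integral>\<^sup>+y. restr_norm \<Omega> y * G y \<partial>sph_meas 0)"
      by (rule nn_integral_sph_meas[symmetric]) measurable
    finally show ?thesis by (simp only: c_def)
  next
    case False
    with q have q: "q > 1" by simp
    define s where "s d = (if d then q / (q - 1) else q)" for d
    have "(\<integral>\<^sup>+y. restr_norm \<Omega> y * G y \<partial>sph_meas 0) = eLp (sph_meas 0) 1 (\<lambda>y. \<Prod>d\<in>UNIV. if d then restr_norm \<Omega> y else G y)"
      by (simp add: eLp_1 UNIV_bool mult.commute)
    also have "\<dots> \<le> (\<Prod>d\<in>UNIV. eLp (sph_meas 0) (s d) (\<lambda>y. if d then restr_norm \<Omega> y else G y))"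
      using q by (intro Holder_eLp) (auto simp: s_def UNIV_bool field_simps)
    also have "\<dots> = eLp (sph_meas 0) (q / (q - 1)) (restr_norm \<Omega>) * eLp (sph_meas 0) q G"
      by (simp add: UNIV_bool s_def mult.commute)
    also have "eLp (sph_meas 0) (q / (q - 1)) (restr_norm \<Omega>) = Lconj_norm_S0 p q \<Omega>"
    proof -
      have "(\<integral>\<^sup>+y. epowr (restr_norm \<Omega> y) (q / (q - 1)) \<partial>sph_meas 0)
        = (\<integral>\<^sup>+y\<in>sphp p 0. ennreal (norm (\<Omega> y) powr (q / (q - 1))) \<partial>haar p)"
        by (subst nn_integral_sph_meas)
          (auto intro!: nn_integral_cong split: split_indicator simp: epowr_ennreal restr_norm_sphere)
      then show ?thesis
        using q by (simp add: Lconj_norm_S0_def eLp_def)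
    qed
    finally show ?thesis .
  qed
qed

section \<open>Morrey-Herz norms as sequence norms\<close>

lemma MK_norm_eLp:
  assumes "l > 0"
  shows "MK_norm p b \<mu> l s w f = (SUP k0::int. ppow (- real_of_int k0 * \<mu>) *
    eLp (count_space {..k0}) l (\<lambda>k. ppow (real_of_int k * b) * wLnorm p s w (sphp p k) f))"
  unfolding MK_norm_def eLp_def using assms
  by (simp add: infsum_ennreal_eq_nn_integral epowr_mult epowr_ppow ppow_def[symmetric])

text \<open>Substituting k + g for k moves the cutoff from k0 to k0 - g and costs p^(gb); the
  supremum defining the norm is then used at k0 - g, which costs p^((k0-g)\<mu>).\<close>

lemma eLp_shift_le_MK_norm:
  assumes l: "l > 0"
  shows "eLp (count_space {..k0}) l (\<lambda>k. ppow (real_of_int k * b) * wLnorm p s w (sphp p (k - g)) f)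
    \<le> ppow (real_of_int g * b + real_of_int (k0 - g) * \<mu>) * MK_norm p b \<mu> l s w f"
proof -
  define X where "X k = wLnorm p s w (sphp p k) f" for k
  have bij: "bij_betw (\<lambda>k. k - g) {..k0} {..k0 - g}"
    by (rule bij_betw_byWitness[where f' = "\<lambda>k. k + g"]) auto
  have "(\<integral>\<^sup>+k. epowr (ppow (real_of_int k * b) * X (k - g)) l \<partial>count_space {..k0})
    = (\<integral>\<^sup>+k. epowr (ppow (real_of_int (k + g) * b) * X k) l \<partial>count_space {..k0 - g})"
    using nn_integral_bij_count_space[OF bij, of "\<lambda>k. epowr (ppow (real_of_int (k + g) * b) * X k) l"] by simp
  then have "eLp (count_space {..k0}) l (\<lambda>k. ppow (real_of_int k * b) * X (k - g))
    = eLp (count_space {..k0 - g}) l (\<lambda>k. ppow (real_of_int (k + g) * b) * X k)"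
    by (simp add: eLp_def)
  also have "\<dots> = eLp (count_space {..k0 - g}) l (\<lambda>k. ppow (real_of_int g * b) * (ppow (real_of_int k * b) * X k))"
  proof -
    have "ppow (real_of_int (k + g) * b) * X k = ppow (real_of_int g * b) * (ppow (real_of_int k * b) * X k)" for k
    proof -
      have "real_of_int (k + g) * b = real_of_int g * b + real_of_int k * b" by (simp add: distrib_right)
      then show ?thesis by (simp only: ppow_add mult.assoc)
    qed
    then show ?thesis by simp
  qed
  also have "\<dots> = ppow (real_of_int g * b) * eLp (count_space {..k0 - g}) l (\<lambda>k. ppow (real_of_int k * b) * X k)"
    using l by (intro eLp_cmult) auto
  \<comment> \<open>A factor 1 is inserted to recreate the normalisation of the supremum at k0 -
    g.\<close>
  also have "\<dots> = ppow (real_of_int g * b) * (ppow (real_of_int (k0 - g) * \<mu>) * (ppow (- real_of_int (k0 - g) * \<mu>) *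
     eLp (count_space {..k0 - g}) l (\<lambda>k. ppow (real_of_int k * b) * X k)))"
  proof -
    have "ppow (real_of_int (k0 - g) * \<mu>) * (ppow (- real_of_int (k0 - g) * \<mu>) * z) = z" for z
    proof -
      have "ppow (real_of_int (k0 - g) * \<mu>) * ppow (- real_of_int (k0 - g) * \<mu>) = 1"
        by (simp only: mult_minus_left right_minus ppow_0 flip: ppow_add)
      then show ?thesis by (simp add: mult.assoc[symmetric])
    qed
    then show ?thesis by simp
  qed
  also have "\<dots> \<le> ppow (real_of_int g * b) * (ppow (real_of_int (k0 - g) * \<mu>) * MK_norm p b \<mu> l s w f)"
    unfolding MK_norm_eLp[OF l] X_def by (intro mult_left_mono SUP_upper) auto
  finally show ?thesis by (simp add: X_def ppow_add mult.assoc)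
qed

section \<open>The commutator on a single sphere\<close>

context
  fixes m :: nat and \<Phi> :: "qp \<Rightarrow> real" and \<Omega> :: "'n::finite qpn \<Rightarrow> complex"
    and b f :: "nat \<Rightarrow> 'n qpn \<Rightarrow> complex"
  assumes \<Phi>: "\<And>x. x \<in> Qp_carrier p \<Longrightarrow> \<Phi> x \<ge> 0"
    and \<Omega>: "\<Omega> \<in> borel_measurable (restrict_space (haar p) (sphp p 0))"
    and measurable_b [measurable]: "\<And>i. i \<in> {1..m} \<Longrightarrow> b i \<in> borel_measurable (haar p)"
    and measurable_f [measurable]: "\<And>i. i \<in> {1..m} \<Longrightarrow> f i \<in> borel_measurable (haar p)"
begin

text \<open>The modulus of the integrand apart from \<Phi> and \<Omega>, as a function of the pair
  (x, y), so that Tonelli and the Hoelder inequality on the product apply.\<close>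

definition kernel :: "int \<Rightarrow> int \<Rightarrow> 'n qpn \<times> 'n qpn \<Rightarrow> ennreal" where
  "kernel k g z = (\<Prod>i=1..m. ennreal (norm (b i (fst z) - b i (qpn_ppow_scale (g - k) (snd z))))) *
     (\<Prod>i=1..m. ennreal (norm (f i (qpn_ppow_scale (g - k) (snd z)))))"

definition coef :: "int \<Rightarrow> ennreal" where
  "coef g = ennreal (\<Phi> (qp_ppow g) / real p powr real_of_int g)"

lemma measurable_kernel [measurable]: "kernel k g \<in> borel_measurable (haar p \<Otimes>\<^sub>M haar p)"
  unfolding kernel_def by measurable

lemma \<Phi>_nonneg: "\<Phi> (qp_ppow g) \<ge> 0"
proof (rule \<Phi>)
  show "qp_ppow g \<in> Qp_carrier p"
    using p_ge_2 by (auto simp: Qp_carrier_def qp_ppow_def intro!: exI[of _ g])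
qed

text \<open>The triangle inequality for the sum over \<gamma> and for each integral. After this step
  only nonnegative measurable majorants occur.\<close>

lemma norm_Hcomm_le:
  assumes x: "x \<in> sphp p k"
  shows "ennreal (norm (Hcomm p \<Phi> \<Omega> m b f x)) \<le>
    (\<integral>\<^sup>+g. coef g * (\<integral>\<^sup>+y. restr_norm \<Omega> y * kernel k g (x, y) \<partial>sph_meas 0) \<partial>count_space UNIV)"
proof -
  note [measurable] = measurable_restr_norm[OF \<Omega>]
  have "ennreal (norm (Hcomm p \<Phi> \<Omega> m b f x)) \<le> (\<integral>\<^sup>+g. ennreal (norm (LINT y:sphp p 0|haar p.
        complex_of_real (\<Phi> (qp_ppow g) / real p powr real_of_int g) * \<Omega> y *
        (\<Prod>i\<in>{1..m}. b i x - b i (qpn_ppow_scale (g - k) y)) *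
        (\<Prod>i\<in>{1..m}. f i (qpn_ppow_scale (g - k) y)))) \<partial>count_space UNIV)"
    unfolding Hcomm_def sphp_normexp[OF x] by (rule ennreal_norm_infsum_le) simp
  also have "\<dots> \<le> (\<integral>\<^sup>+g. coef g * (\<integral>\<^sup>+y. restr_norm \<Omega> y * kernel k g (x, y) \<partial>sph_meas 0) \<partial>count_space UNIV)"
  proof (rule nn_integral_mono)
    fix g :: int
    let ?h = "\<lambda>y. complex_of_real (\<Phi> (qp_ppow g) / real p powr real_of_int g) * \<Omega> y *
        (\<Prod>i\<in>{1..m}. b i x - b i (qpn_ppow_scale (g - k) y)) *
        (\<Prod>i\<in>{1..m}. f i (qpn_ppow_scale (g - k) y))"
    have "ennreal (norm (LINT y:sphp p 0|haar p. ?h y)) \<le> (\<integral>\<^sup>+y. ennreal (norm (indicator (sphp p 0) y *\<^sub>R ?h y)) \<partial>haar p)"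
      unfolding set_lebesgue_integral_def by (rule ennreal_norm_integral_le)
    also have "\<dots> = (\<integral>\<^sup>+y. coef g * (restr_norm \<Omega> y * kernel k g (x, y) * indicator (sphp p 0) y) \<partial>haar p)"
    proof (rule nn_integral_cong)
      fix y
      have "ennreal (norm (?h y)) = coef g * (ennreal (norm (\<Omega> y)) * kernel k g (x, y))"
      proof -
        have "norm (?h y) = \<Phi> (qp_ppow g) / real p powr real_of_int g * (norm (\<Omega> y) *
            (norm (\<Prod>i\<in>{1..m}. b i x - b i (qpn_ppow_scale (g - k) y)) * norm (\<Prod>i\<in>{1..m}. f i (qpn_ppow_scale (g - k) y))))"
          using \<Phi>_nonneg[of g] by (simp only: norm_mult norm_of_real mult.assoc) simp
        then show ?thesis
          using \<Phi>_nonneg[of g]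
          by (simp only: kernel_def coef_def ennreal_mult divide_nonneg_nonneg powr_ge_zero mult_nonneg_nonneg norm_ge_zero
              ennreal_norm_prod fst_conv snd_conv)
      qed
      then show "ennreal (norm (indicator (sphp p 0) y *\<^sub>R ?h y)) = coef g * (restr_norm \<Omega> y * kernel k g (x, y) * indicator (sphp p 0) y)"
        by (auto split: split_indicator simp: restr_norm_sphere)
    qed
    also have "\<dots> = coef g * (\<integral>\<^sup>+y. restr_norm \<Omega> y * kernel k g (x, y) \<partial>sph_meas 0)"
      by (simp add: nn_integral_cmult nn_integral_sph_meas)
    finally show "ennreal (norm (LINT y:sphp p 0|haar p. ?h y)) \<le> \<dots>" .
  qed
  finally show ?thesis .
qed

text \<open>Hoelder against \<Omega> leaves an L^q norm in y inside an L^q norm in x, hence the L^q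
  norm of the kernel on the product.\<close>

lemma eLp_kernel_le:
  assumes q: "q \<ge> 1" and exps: "\<And>i. i \<in> {1..m} \<Longrightarrow> qi i \<ge> 1" "\<And>i. i \<in> {1..m} \<Longrightarrow> ri i \<ge> 1"
    and sum: "(\<Sum>i=1..m. 1 / qi i) + (\<Sum>i=1..m. 1 / ri i) = 1 / q"
  shows "eLp (sph_meas k) q (\<lambda>x. coef g * (\<integral>\<^sup>+y. restr_norm \<Omega> y * kernel k g (x, y) \<partial>sph_meas 0)) \<le>
    coef g * Lconj_norm_S0 p q \<Omega> *
      ((\<Prod>i=1..m. eLp (sph_meas k \<Otimes>\<^sub>M sph_meas 0) (ri i) (\<lambda>z. ennreal (norm (b i (fst z) - b i (qpn_ppow_scale (g - k) (snd z)))))) *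
       (\<Prod>i=1..m. eLp ((sph_meas k :: 'n qpn measure) \<Otimes>\<^sub>M sph_meas 0) (qi i) (\<lambda>z. ennreal (norm (f i (qpn_ppow_scale (g - k) (snd z)))))))"
proof -
  let ?M = "sph_meas k \<Otimes>\<^sub>M sph_meas 0 :: ('n qpn \<times> 'n qpn) measure"
  have qpos: "q > 0" using q by simp
  interpret S: sigma_finite_measure "sph_meas 0 :: 'n qpn measure" by (rule sigma_finite_sph_meas)
  have sets_M: "sets ?M = sets (haar p \<Otimes>\<^sub>M haar p)"
    by (intro sets_pair_measure_cong) simp_all
  have [measurable]: "kernel k g \<in> borel_measurable ?M"
    using measurable_kernel by (subst measurable_cong_sets[OF sets_M refl])
  have kernel_x: "(\<lambda>y. kernel k g (x, y)) \<in> borel_measurable (haar p)" for x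
    by measurable
  have [measurable]: "(\<lambda>x. eLp (sph_meas 0) q (\<lambda>y. kernel k g (x, y))) \<in> borel_measurable (sph_meas k :: 'n qpn measure)"
    unfolding eLp_def by measurable
  have "eLp (sph_meas k) q (\<lambda>x. coef g * (\<integral>\<^sup>+y. restr_norm \<Omega> y * kernel k g (x, y) \<partial>sph_meas 0)) \<le>
    eLp (sph_meas k) q (\<lambda>x. (coef g * Lconj_norm_S0 p q \<Omega>) * eLp (sph_meas 0) q (\<lambda>y. kernel k g (x, y)))"
    unfolding mult.assoc by (intro eLp_mono[OF qpos] mult_left_mono Holder_unit_sphere q \<Omega> kernel_x) simp
  also have "\<dots> = coef g * Lconj_norm_S0 p q \<Omega> * eLp (sph_meas k) q (\<lambda>x. eLp (sph_meas 0) q (\<lambda>y. kernel k g (x, y)))"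
    using qpos by (intro eLp_cmult) auto
  also have "eLp (sph_meas k) q (\<lambda>x. eLp (sph_meas 0) q (\<lambda>y. kernel k g (x, y))) = eLp ?M q (kernel k g)"
    using qpos by (intro eLp_pair S.sigma_finite_measure_axioms) auto
  also have "eLp ?M q (kernel k g) \<le>
       (\<Prod>i=1..m. eLp ?M (ri i) (\<lambda>z. ennreal (norm (b i (fst z) - b i (qpn_ppow_scale (g - k) (snd z)))))) *
       (\<Prod>i=1..m. eLp ?M (qi i) (\<lambda>z. ennreal (norm (f i (qpn_ppow_scale (g - k) (snd z))))))"
  proof -
    \<comment> \<open>A disjoint sum of two copies of the indices lists all 2m factors:
      \<open>Inl\<close> for the differences of b_i with exponents r_i, \<open>Inr\<close> for the
      f_i with exponents q_i.\<close>
    define F where "F j = (case j of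
        Inl i \<Rightarrow> (\<lambda>z. ennreal (norm (b i (fst z) - b i (qpn_ppow_scale (g - k) (snd z)))))
      | Inr i \<Rightarrow> (\<lambda>z::'n qpn \<times> 'n qpn. ennreal (norm (f i (qpn_ppow_scale (g - k) (snd z))))))" for j
    define s where "s j = (case j of Inl i \<Rightarrow> ri i | Inr i \<Rightarrow> qi i)" for j :: "nat + nat"
    have "eLp ?M q (\<lambda>z. \<Prod>j\<in>{1..m} <+> {1..m}. F j z) \<le> (\<Prod>j\<in>{1..m} <+> {1..m}. eLp ?M (s j) (F j))"
    proof (rule Holder_eLp)
      show "0 < s j" if "j \<in> {1..m} <+> {1..m}" for j
        using that exps by (force simp: s_def)
      show "(\<Sum>j\<in>{1..m} <+> {1..m}. 1 / s j) = 1 / q"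
        using sum by (simp add: sum.Plus s_def add.commute)
      show "F j \<in> borel_measurable ?M" if "j \<in> {1..m} <+> {1..m}" for j
      proof (subst measurable_cong_sets[OF sets_M refl])
        show "F j \<in> borel_measurable (haar p \<Otimes>\<^sub>M haar p)"
          using that by (auto simp: F_def)
      qed
    qed (use qpos in auto)
    then show ?thesis
      by (simp add: prod.Plus F_def s_def kernel_def[abs_def])
  qed
  finally show ?thesis by (simp add: mult_left_mono)
qed

section \<open>Balance of exponents and summation\<close>

context
  fixes n :: real and Kb Kf :: "nat \<Rightarrow> ennreal" and q \<alpha> ell :: real and qi ri \<alpha>i \<beta>i ell_i lam_i :: "nat \<Rightarrow> real"
  assumes n: "n = real CARD('n)"
    and Kb: "\<And>i. Kb i = epowr (s0 TYPE('n) * w0 TYPE('n) (\<alpha>i i)) (1 / ri i)"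
    and Kf: "\<And>i. Kf i = epowr (s0 TYPE('n)) (1 / qi i)"
    and q: "q \<ge> 1" and qi: "\<And>i. i \<in> {1..m} \<Longrightarrow> qi i \<ge> 1" and ri: "\<And>i. i \<in> {1..m} \<Longrightarrow> ri i \<ge> 1"
    and \<alpha>i: "\<And>i. i \<in> {1..m} \<Longrightarrow> \<alpha>i i > - n"
    and ell: "ell \<ge> 1" and ell_i: "\<And>i. i \<in> {1..m} \<Longrightarrow> ell_i i \<ge> 1"
    and sum_exps: "(\<Sum>i=1..m. 1 / qi i) + (\<Sum>i=1..m. 1 / ri i) = 1 / q"
    and sum_weights: "(\<Sum>i=1..m. \<alpha>i i / qi i) + (\<Sum>i=1..m. \<alpha>i i / ri i) = \<alpha> / q"
    and sum_ell: "(\<Sum>i=1..m. 1 / ell_i i) = 1 / ell"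
    and CMO: "\<And>i. i \<in> {1..m} \<Longrightarrow> b i \<in> CMO_space p (ri i) (\<lambda>x. qpn_norm p x powr \<alpha>i i)"
begin

abbreviation "bnm i \<equiv> CMO_norm p (ri i) (\<lambda>x. qpn_norm p x powr \<alpha>i i) (b i)"
abbreviation "fnm i \<equiv> MK_norm p (\<beta>i i) (lam_i i) (ell_i i) (qi i) (\<lambda>x. qpn_norm p x powr \<alpha>i i) (f i)"
abbreviation "fsph i k \<equiv> wLnorm p (qi i) (\<lambda>x. qpn_norm p x powr \<alpha>i i) (sphp p k) (f i)"
abbreviation "growth g i \<equiv> 2 + ppow (real_of_int \<bar>g\<bar> * (\<alpha>i i + n))"
abbreviation "\<beta>s \<equiv> (\<Sum>i=1..m. \<beta>i i) - (\<Sum>i=1..m. (n + \<alpha>i i) / ri i)"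
abbreviation "lam_s \<equiv> (\<Sum>i=1..m. lam_i i)"
text \<open>The exponent of p^g left by the dilations of the f_i. By the two balance conditions it
  equals (n + \<alpha>)/q minus the sum of (n + \<alpha>_i)/r_i.\<close>

abbreviation "slope \<equiv> (\<Sum>i=1..m. (n + \<alpha>i i) / qi i)"
abbreviation "Kall \<equiv> (\<Prod>i=1..m. Kb i) * (\<Prod>i=1..m. Kf i)"

lemma wLnorm_Hcomm_le:
  "wLnorm p q (\<lambda>x. qpn_norm p x powr \<alpha>) (sphp p k) (Hcomm p \<Phi> \<Omega> m b f) \<le>
   (\<integral>\<^sup>+g. ppow (real_of_int k * \<alpha> / q) * (coef g * Lconj_norm_S0 p q \<Omega> *
      ((\<Prod>i=1..m. Kb i * ppow (real_of_int k * n / ri i) * growth g i * bnm i) *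
       (\<Prod>i=1..m. Kf i * ppow (real_of_int k * n / qi i + real_of_int (g - k) * (n + \<alpha>i i) / qi i) * fsph i (k - g)))) \<partial>count_space UNIV)"
proof -
  have qpos: "q > 0" using q by simp
  note [measurable] = measurable_restr_norm[OF \<Omega>]
  interpret S: sigma_finite_measure "sph_meas 0 :: 'n qpn measure" by (rule sigma_finite_sph_meas)
  have [measurable]: "kernel k g \<in> borel_measurable (haar p \<Otimes>\<^sub>M sph_meas 0)" for g
    by (subst measurable_cong_sets[OF sets_pair_measure_cong[OF refl sets_sph_meas] refl]) (rule measurable_kernel)
  define h where "h g x = coef g * (\<integral>\<^sup>+y. restr_norm \<Omega> y * kernel k g (x, y) \<partial>sph_meas 0)" for g x
  have h [measurable]: "h g \<in> borel_measurable (haar p)" for g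
    unfolding h_def by measurable
  have sum_h: "(\<lambda>x. \<integral>\<^sup>+g. h g x \<partial>count_space UNIV) \<in> borel_measurable (haar p)"
    by (rule measurable_nn_integral_count_space) auto
  have "wLnorm p q (\<lambda>x. qpn_norm p x powr \<alpha>) (sphp p k) (Hcomm p \<Phi> \<Omega> m b f) \<le>
     ppow (real_of_int k * \<alpha> / q) * eLp (sph_meas k) q (\<lambda>x. \<integral>\<^sup>+g. h g x \<partial>count_space UNIV)"
    by (rule wLnorm_sphere_le[OF qpos sum_h]) (unfold h_def, rule norm_Hcomm_le)
  also have "\<dots> \<le> ppow (real_of_int k * \<alpha> / q) * (\<integral>\<^sup>+g. eLp (sph_meas k) q (h g) \<partial>count_space UNIV)"
    by (intro mult_left_mono Minkowski_eLp q) auto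
  also have "\<dots> = (\<integral>\<^sup>+g. ppow (real_of_int k * \<alpha> / q) * eLp (sph_meas k) q (h g) \<partial>count_space UNIV)"
    by (simp add: nn_integral_cmult)
  also have "\<dots> \<le> (\<integral>\<^sup>+g. ppow (real_of_int k * \<alpha> / q) * (coef g * Lconj_norm_S0 p q \<Omega> *
      ((\<Prod>i=1..m. Kb i * ppow (real_of_int k * n / ri i) * growth g i * bnm i) *
       (\<Prod>i=1..m. Kf i * ppow (real_of_int k * n / qi i + real_of_int (g - k) * (n + \<alpha>i i) / qi i) * fsph i (k - g)))) \<partial>count_space UNIV)"
  proof (intro nn_integral_mono mult_left_mono)
    fix g :: int
    have "eLp (sph_meas k) q (h g) \<le> coef g * Lconj_norm_S0 p q \<Omega> *
      ((\<Prod>i=1..m. eLp (sph_meas k \<Otimes>\<^sub>M sph_meas 0) (ri i) (\<lambda>z. ennreal (norm (b i (fst z) - b i (qpn_ppow_scale (g - k) (snd z)))))) *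
       (\<Prod>i=1..m. eLp ((sph_meas k :: 'n qpn measure) \<Otimes>\<^sub>M sph_meas 0) (qi i) (\<lambda>z. ennreal (norm (f i (qpn_ppow_scale (g - k) (snd z)))))))"
      unfolding h_def by (rule eLp_kernel_le[OF q qi ri sum_exps])
    also have "(\<Prod>i=1..m. eLp (sph_meas k \<Otimes>\<^sub>M sph_meas 0) (ri i) (\<lambda>z. ennreal (norm (b i (fst z) - b i (qpn_ppow_scale (g - k) (snd z))))))
      \<le> (\<Prod>i=1..m. Kb i * ppow (real_of_int k * n / ri i) * growth g i * bnm i)"
    proof (rule prod_mono_ennreal)
      fix i assume "i \<in> {1..m}"
      then show "eLp (sph_meas k \<Otimes>\<^sub>M sph_meas 0) (ri i) (\<lambda>z. ennreal (norm (b i (fst z) - b i (qpn_ppow_scale (g - k) (snd z)))))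
        \<le> Kb i * ppow (real_of_int k * n / ri i) * growth g i * bnm i"
        using eLp_commutator_factor[OF ri \<alpha>i[unfolded n] CMO, folded n Kb] by blast
    qed
    also have "(\<Prod>i=1..m. eLp ((sph_meas k :: 'n qpn measure) \<Otimes>\<^sub>M sph_meas 0) (qi i) (\<lambda>z. ennreal (norm (f i (qpn_ppow_scale (g - k) (snd z)))))) =
       (\<Prod>i=1..m. Kf i * ppow (real_of_int k * n / qi i + real_of_int (g - k) * (n + \<alpha>i i) / qi i) * fsph i (k - g))"
    proof (intro prod.cong refl)
      fix i assume i: "i \<in> {1..m}"
      show "eLp ((sph_meas k :: 'n qpn measure) \<Otimes>\<^sub>M sph_meas 0) (qi i) (\<lambda>z. ennreal (norm (f i (qpn_ppow_scale (g - k) (snd z))))) =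
         Kf i * ppow (real_of_int k * n / qi i + real_of_int (g - k) * (n + \<alpha>i i) / qi i) * fsph i (k - g)"
        unfolding Kf n by (intro eLp_scaled_factor measurable_f i less_le_trans[OF zero_less_one qi])
    qed
    finally show "eLp (sph_meas k) q (h g) \<le> coef g * Lconj_norm_S0 p q \<Omega> *
      ((\<Prod>i=1..m. Kb i * ppow (real_of_int k * n / ri i) * growth g i * bnm i) *
       (\<Prod>i=1..m. Kf i * ppow (real_of_int k * n / qi i + real_of_int (g - k) * (n + \<alpha>i i) / qi i) * fsph i (k - g)))"
      by (simp add: mult_left_mono mult_right_mono)
  qed simp
  finally show ?thesis .
qed

lemma weight_sums:
  "slope = n * (\<Sum>i=1..m. 1 / qi i) + (\<Sum>i=1..m. \<alpha>i i / qi i)"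
  "(\<Sum>i=1..m. (n + \<alpha>i i) / ri i) = n * (\<Sum>i=1..m. 1 / ri i) + (\<Sum>i=1..m. \<alpha>i i / ri i)"
  by (simp_all add: add_divide_distrib sum.distrib sum_distrib_left)

text \<open>In the coefficient of k the terms with n cancel between the masses of S_k,
  \<open>\<beta>s\<close> and \<open>slope\<close>, the terms with \<alpha>_i cancel by the balance
  of the weights, and only the sum of the \<beta>_i survives.\<close>

lemma exponent_identity:
  "real_of_int k * \<beta>s + real_of_int k * \<alpha> / q + (\<Sum>i=1..m. real_of_int k * n / ri i) +
     (\<Sum>i=1..m. real_of_int k * n / qi i + real_of_int (g - k) * (n + \<alpha>i i) / qi i) =
   real_of_int g * slope + (\<Sum>i=1..m. real_of_int k * \<beta>i i)"
proof -
  have 1: "(\<Sum>i=1..m. real_of_int k * n / ri i) = real_of_int k * n * (\<Sum>i=1..m. 1 / ri i)"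
    "(\<Sum>i=1..m. real_of_int k * \<beta>i i) = real_of_int k * (\<Sum>i=1..m. \<beta>i i)"
    "(\<Sum>i=1..m. real_of_int k * n / qi i + real_of_int (g - k) * (n + \<alpha>i i) / qi i) =
      real_of_int k * n * (\<Sum>i=1..m. 1 / qi i) + (real_of_int g - real_of_int k) * slope"
    by (simp_all add: sum.distrib sum_distrib_left)
  have 2: "real_of_int k * \<alpha> / q = real_of_int k * ((\<Sum>i=1..m. \<alpha>i i / qi i) + (\<Sum>i=1..m. \<alpha>i i / ri i))"
    unfolding sum_weights by simp
  show ?thesis
    unfolding 1 2 weight_sums by algebra
qed

text \<open>The cutoff k0 cancels because \<open>lam_s\<close> is the sum of the
  \<open>lam_i\<close>; the remaining multiple of g is the exponent in the series
  \<open>C8\<close>.\<close>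

lemma exponent_identity_C8:
  "- real_of_int g + real_of_int g * slope + (\<Sum>i=1..m. real_of_int g * \<beta>i i + real_of_int (k0 - g) * lam_i i)
     - real_of_int k0 * lam_s = - (real_of_int g * (1 - \<beta>s - (n + \<alpha>) / q + lam_s))"
proof -
  have 1: "(\<Sum>i=1..m. real_of_int g * \<beta>i i + real_of_int (k0 - g) * lam_i i) =
     real_of_int g * (\<Sum>i=1..m. \<beta>i i) + (real_of_int k0 - real_of_int g) * lam_s"
    by (simp add: sum.distrib sum_distrib_left)
  have 2: "(n + \<alpha>) / q = n * ((\<Sum>i=1..m. 1 / qi i) + (\<Sum>i=1..m. 1 / ri i)) +
     ((\<Sum>i=1..m. \<alpha>i i / qi i) + (\<Sum>i=1..m. \<alpha>i i / ri i))"
    unfolding sum_weights sum_exps by (simp add: add_divide_distrib)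
  show ?thesis
    unfolding 1 2 weight_sums by algebra
qed

text \<open>All dependence on k is now in the last product, whose factors are the terms of the
  sequence norms of the f_i, shifted by g.\<close>

lemma scaled_wLnorm_Hcomm_le:
  "ppow (real_of_int k * \<beta>s) * wLnorm p q (\<lambda>x. qpn_norm p x powr \<alpha>) (sphp p k) (Hcomm p \<Phi> \<Omega> m b f) \<le>
   (\<integral>\<^sup>+g. (coef g * Lconj_norm_S0 p q \<Omega> * Kall * (\<Prod>i=1..m. growth g i) * (\<Prod>i=1..m. bnm i) * ppow (real_of_int g * slope)) *
      (\<Prod>i=1..m. ppow (real_of_int k * \<beta>i i) * fsph i (k - g)) \<partial>count_space UNIV)"
proof -
  have "ppow (real_of_int k * \<beta>s) * wLnorm p q (\<lambda>x. qpn_norm p x powr \<alpha>) (sphp p k) (Hcomm p \<Phi> \<Omega> m b f) \<le>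
    (\<integral>\<^sup>+g. ppow (real_of_int k * \<beta>s) * (ppow (real_of_int k * \<alpha> / q) * (coef g * Lconj_norm_S0 p q \<Omega> *
      ((\<Prod>i=1..m. Kb i * ppow (real_of_int k * n / ri i) * growth g i * bnm i) *
       (\<Prod>i=1..m. Kf i * ppow (real_of_int k * n / qi i + real_of_int (g - k) * (n + \<alpha>i i) / qi i) * fsph i (k - g))))) \<partial>count_space UNIV)"
    using mult_left_mono[OF wLnorm_Hcomm_le[of k], of "ppow (real_of_int k * \<beta>s)"]
    by (simp add: nn_integral_cmult)
  also have "\<dots> = (\<integral>\<^sup>+g. (coef g * Lconj_norm_S0 p q \<Omega> * Kall * (\<Prod>i=1..m. growth g i) * (\<Prod>i=1..m. bnm i) * ppow (real_of_int g * slope)) *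
      (\<Prod>i=1..m. ppow (real_of_int k * \<beta>i i) * fsph i (k - g)) \<partial>count_space UNIV)"
  proof (rule nn_integral_cong)
    fix g :: int
    define u where "u i = real_of_int k * n / qi i + real_of_int (g - k) * (n + \<alpha>i i) / qi i" for i
    have "ppow (real_of_int k * \<beta>s) * ppow (real_of_int k * \<alpha> / q) * (\<Prod>i=1..m. ppow (real_of_int k * n / ri i)) *
      (\<Prod>i=1..m. ppow (u i)) = ppow (real_of_int g * slope) * (\<Prod>i=1..m. ppow (real_of_int k * \<beta>i i))"
      using exponent_identity[of k g, folded u_def]
      by (simp only: finite_atLeastAtMost flip: ppow_add ppow_sum)
    note eq = this
    have "ppow (real_of_int k * \<beta>s) * (ppow (real_of_int k * \<alpha> / q) * (coef g * Lconj_norm_S0 p q \<Omega> *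
      ((\<Prod>i=1..m. Kb i * ppow (real_of_int k * n / ri i) * growth g i * bnm i) *
       (\<Prod>i=1..m. Kf i * ppow (u i) * fsph i (k - g))))) =
      (ppow (real_of_int k * \<beta>s) * ppow (real_of_int k * \<alpha> / q) * (\<Prod>i=1..m. ppow (real_of_int k * n / ri i)) *
      (\<Prod>i=1..m. ppow (u i))) * (coef g * Lconj_norm_S0 p q \<Omega> * Kall * (\<Prod>i=1..m. growth g i) * (\<Prod>i=1..m. bnm i) * (\<Prod>i=1..m. fsph i (k - g)))"
      unfolding prod.distrib by (simp only: mult_ac)
    also have "\<dots> = (coef g * Lconj_norm_S0 p q \<Omega> * Kall * (\<Prod>i=1..m. growth g i) * (\<Prod>i=1..m. bnm i) * ppow (real_of_int g * slope)) *
      (\<Prod>i=1..m. ppow (real_of_int k * \<beta>i i) * fsph i (k - g))"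
      unfolding eq prod.distrib by (simp only: mult_ac)
    finally show "ppow (real_of_int k * \<beta>s) * (ppow (real_of_int k * \<alpha> / q) * (coef g * Lconj_norm_S0 p q \<Omega> *
      ((\<Prod>i=1..m. Kb i * ppow (real_of_int k * n / ri i) * growth g i * bnm i) *
       (\<Prod>i=1..m. Kf i * ppow (real_of_int k * n / qi i + real_of_int (g - k) * (n + \<alpha>i i) / qi i) * fsph i (k - g))))) = \<dots>"
      by (simp only: u_def)
  qed
  finally show ?thesis .
qed

lemma MK_norm_Hcomm_le:
  "MK_norm p \<beta>s lam_s ell q (\<lambda>x. qpn_norm p x powr \<alpha>) (Hcomm p \<Phi> \<Omega> m b f) \<le>
     Kall * (\<Sum>\<^sub>\<infinity> g::int. ennreal (\<Phi> (qp_ppow g) / real p powr (real_of_int g * (1 - \<beta>s - (n + \<alpha>) / q + lam_s)) *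
        (\<Prod>i=1..m. 2 + real p powr (real_of_int \<bar>g\<bar> * (\<alpha>i i + n))))) *
     Lconj_norm_S0 p q \<Omega> * (\<Prod>i=1..m. bnm i) * (\<Prod>i=1..m. fnm i)"
proof -
  have ellpos: "ell > 0" using ell by simp
  \<comment> \<open>The part of the g-th term that does not depend on k and passes through the norm
    in k.\<close>
  define D where "D g = coef g * Lconj_norm_S0 p q \<Omega> * Kall * (\<Prod>i=1..m. growth g i) * (\<Prod>i=1..m. bnm i) * ppow (real_of_int g * slope)" for g
  define T where "T g = ennreal (\<Phi> (qp_ppow g) / real p powr (real_of_int g * (1 - \<beta>s - (n + \<alpha>) / q + lam_s)) *
        (\<Prod>i=1..m. 2 + real p powr (real_of_int \<bar>g\<bar> * (\<alpha>i i + n))))" for g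
  define W where "W k = wLnorm p q (\<lambda>x. qpn_norm p x powr \<alpha>) (sphp p k) (Hcomm p \<Phi> \<Omega> m b f)" for k
  have "ppow (- real_of_int k0 * lam_s) * eLp (count_space {..k0}) ell (\<lambda>k. ppow (real_of_int k * \<beta>s) * W k) \<le>
     (\<integral>\<^sup>+g. Kall * Lconj_norm_S0 p q \<Omega> * (\<Prod>i=1..m. bnm i) * (\<Prod>i=1..m. fnm i) * T g \<partial>count_space UNIV)" for k0
  proof -
    have "eLp (count_space {..k0}) ell (\<lambda>k. ppow (real_of_int k * \<beta>s) * W k) \<le>
      eLp (count_space {..k0}) ell (\<lambda>k. \<integral>\<^sup>+g. D g * (\<Prod>i=1..m. ppow (real_of_int k * \<beta>i i) * fsph i (k - g)) \<partial>count_space UNIV)"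
      unfolding W_def D_def by (intro eLp_mono ellpos scaled_wLnorm_Hcomm_le)
    also have "\<dots> \<le> (\<integral>\<^sup>+g. eLp (count_space {..k0}) ell (\<lambda>k. D g * (\<Prod>i=1..m. ppow (real_of_int k * \<beta>i i) * fsph i (k - g))) \<partial>count_space UNIV)"
      by (intro Minkowski_eLp ell) auto
    also have "\<dots> \<le> (\<integral>\<^sup>+g. D g * (\<Prod>i=1..m. ppow (real_of_int g * \<beta>i i + real_of_int (k0 - g) * lam_i i) * fnm i) \<partial>count_space UNIV)"
    proof (rule nn_integral_mono)
      fix g :: int
      have factor: "eLp (count_space {..k0}) ell (\<lambda>k. D g * (\<Prod>i=1..m. ppow (real_of_int k * \<beta>i i) * fsph i (k - g))) =
        D g * eLp (count_space {..k0}) ell (\<lambda>k. (\<Prod>i=1..m. ppow (real_of_int k * \<beta>i i) * fsph i (k - g)))"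
        by (intro eLp_cmult ellpos) simp
      \<comment> \<open>Hoelder in k on the counting measure, where the condition on the reciprocals
        of the \<open>ell_i\<close> enters.\<close>
      have "eLp (count_space {..k0}) ell (\<lambda>k. (\<Prod>i=1..m. ppow (real_of_int k * \<beta>i i) * fsph i (k - g))) \<le>
        (\<Prod>i=1..m. eLp (count_space {..k0}) (ell_i i) (\<lambda>k. ppow (real_of_int k * \<beta>i i) * fsph i (k - g)))"
        by (intro Holder_eLp sum_ell ellpos finite_atLeastAtMost less_le_trans[OF zero_less_one ell_i]) simp_all
      also have "\<dots> \<le> (\<Prod>i=1..m. ppow (real_of_int g * \<beta>i i + real_of_int (k0 - g) * lam_i i) * fnm i)"
        by (intro prod_mono_ennreal eLp_shift_le_MK_norm less_le_trans[OF zero_less_one ell_i])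
      finally have "eLp (count_space {..k0}) ell (\<lambda>k. (\<Prod>i=1..m. ppow (real_of_int k * \<beta>i i) * fsph i (k - g))) \<le>
        (\<Prod>i=1..m. ppow (real_of_int g * \<beta>i i + real_of_int (k0 - g) * lam_i i) * fnm i)" .
      then show "eLp (count_space {..k0}) ell (\<lambda>k. D g * (\<Prod>i=1..m. ppow (real_of_int k * \<beta>i i) * fsph i (k - g))) \<le>
         D g * (\<Prod>i=1..m. ppow (real_of_int g * \<beta>i i + real_of_int (k0 - g) * lam_i i) * fnm i)"
        unfolding factor by (rule mult_left_mono) simp
    qed
    finally have "ppow (- real_of_int k0 * lam_s) * eLp (count_space {..k0}) ell (\<lambda>k. ppow (real_of_int k * \<beta>s) * W k) \<le>
       ppow (- real_of_int k0 * lam_s) * (\<integral>\<^sup>+g. D g * (\<Prod>i=1..m. ppow (real_of_int g * \<beta>i i + real_of_int (k0 - g) * lam_i i) * fnm i) \<partial>count_space UNIV)"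
      by (rule mult_left_mono) simp
    also have "\<dots> = (\<integral>\<^sup>+g. ppow (- real_of_int k0 * lam_s) * (D g * (\<Prod>i=1..m. ppow (real_of_int g * \<beta>i i + real_of_int (k0 - g) * lam_i i) * fnm i)) \<partial>count_space UNIV)"
      by (simp add: nn_integral_cmult)
    also have "\<dots> = (\<integral>\<^sup>+g. Kall * Lconj_norm_S0 p q \<Omega> * (\<Prod>i=1..m. bnm i) * (\<Prod>i=1..m. fnm i) * T g \<partial>count_space UNIV)"
    proof (rule nn_integral_cong)
      fix g :: int
      define v where "v i = real_of_int g * \<beta>i i + real_of_int (k0 - g) * lam_i i" for i
      define t where "t = real_of_int g * (1 - \<beta>s - (n + \<alpha>) / q + lam_s)"
      have T: "T g = ennreal (\<Phi> (qp_ppow g)) * ppow (- t) * (\<Prod>i=1..m. growth g i)"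
      proof -
        define P where "P = (\<Prod>i=1..m. 2 + real p powr (real_of_int \<bar>g\<bar> * (\<alpha>i i + n)))"
        have "0 \<le> P"
          unfolding P_def by (intro prod_nonneg add_nonneg_nonneg) simp_all
        have "growth g i = ennreal (2 + real p powr (real_of_int \<bar>g\<bar> * (\<alpha>i i + n)))" for i
          by (subst ennreal_plus) (simp_all add: ppow_def)
        then have P: "(\<Prod>i=1..m. growth g i) = ennreal P"
          unfolding P_def by (simp only: prod_ennreal add_nonneg_nonneg zero_le_numeral powr_ge_zero)
        have "\<Phi> (qp_ppow g) / real p powr t * P = \<Phi> (qp_ppow g) * real p powr (- t) * P"
          by (simp only: powr_minus divide_inverse)
        then show ?thesis
          unfolding T_def t_def[symmetric] P_def[symmetric] P ppow_def
          using \<Phi>_nonneg[of g] \<open>0 \<le> P\<close> by (simp only: ennreal_mult mult_nonneg_nonneg powr_ge_zero P[unfolded ppow_def])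
      qed
      have coef: "coef g = ennreal (\<Phi> (qp_ppow g)) * ppow (- real_of_int g)"
      proof -
        have "\<Phi> (qp_ppow g) / real p powr real_of_int g = \<Phi> (qp_ppow g) * real p powr (- real_of_int g)"
          by (simp only: powr_minus divide_inverse)
        then show ?thesis
          unfolding coef_def ppow_def using \<Phi>_nonneg[of g] by (simp only: ennreal_mult powr_ge_zero)
      qed
      \<comment> \<open>The right side is free of k0, so the supremum over k0 needs no further
        estimate.\<close>
      have exps: "ppow (- real_of_int k0 * lam_s) * ppow (- real_of_int g) * ppow (real_of_int g * slope) * (\<Prod>i=1..m. ppow (v i)) = ppow (- t)"
      proof -
        have "- real_of_int k0 * lam_s + - real_of_int g + real_of_int g * slope + (\<Sum>i=1..m. v i) = - t"
          using exponent_identity_C8[of g k0, folded v_def t_def] by linarith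
        then show ?thesis by (simp only: finite_atLeastAtMost flip: ppow_add ppow_sum)
      qed
      let ?N = "Kall * Lconj_norm_S0 p q \<Omega> * (\<Prod>i=1..m. bnm i) * (\<Prod>i=1..m. fnm i)"
      have "ppow (- real_of_int k0 * lam_s) * (D g * (\<Prod>i=1..m. ppow (v i) * fnm i)) =
         ?N * (ennreal (\<Phi> (qp_ppow g)) *
           (ppow (- real_of_int k0 * lam_s) * ppow (- real_of_int g) * ppow (real_of_int g * slope) * (\<Prod>i=1..m. ppow (v i))) *
           (\<Prod>i=1..m. growth g i))"
        unfolding D_def prod.distrib coef by (simp only: mult_ac)
      then show "ppow (- real_of_int k0 * lam_s) * (D g * (\<Prod>i=1..m. ppow (real_of_int g * \<beta>i i + real_of_int (k0 - g) * lam_i i) * fnm i)) =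
         ?N * T g"
        unfolding exps unfolding T v_def .
    qed
    finally show ?thesis .
  qed
  then have "MK_norm p \<beta>s lam_s ell q (\<lambda>x. qpn_norm p x powr \<alpha>) (Hcomm p \<Phi> \<Omega> m b f) \<le>
     (\<integral>\<^sup>+g. Kall * Lconj_norm_S0 p q \<Omega> * (\<Prod>i=1..m. bnm i) * (\<Prod>i=1..m. fnm i) * T g \<partial>count_space UNIV)"
    unfolding MK_norm_eLp[OF ellpos] W_def by (intro SUP_least)
  also have "\<dots> = Kall * Lconj_norm_S0 p q \<Omega> * (\<Prod>i=1..m. bnm i) * (\<Prod>i=1..m. fnm i) * infsum T UNIV"
    by (simp add: nn_integral_cmult infsum_ennreal_eq_nn_integral)
  finally show ?thesis
    unfolding T_def by (simp only: mult_ac)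
qed

end

end

end

theorem theorem4p3:
  fixes p :: nat and m :: nat
    and q \<alpha> ell :: real
    and qi ri \<alpha>i \<beta>i ell_i lam_i :: "nat \<Rightarrow> real"
  assumes "prime p" and "m \<ge> 1"
    and "q \<ge> 1" and "\<forall>i\<in>{1..m}. qi i \<ge> 1 \<and> ri i \<ge> 1"
    and "\<forall>i\<in>{1..m}. \<alpha>i i > - real CARD('n::finite)"
    and "ell \<ge> 1" and "\<forall>i\<in>{1..m}. ell_i i \<ge> 1"
    and "\<forall>i\<in>{1..m}. lam_i i \<ge> 0"
    and "(\<Sum>i=1..m. 1 / qi i) + (\<Sum>i=1..m. 1 / ri i) = 1 / q"
    and "(\<Sum>i=1..m. \<alpha>i i / qi i) + (\<Sum>i=1..m. \<alpha>i i / ri i) = \<alpha> / q"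
    and "(\<Sum>i=1..m. 1 / ell_i i) = 1 / ell"
  shows "\<exists>C::real. \<forall>(\<Phi>::qp \<Rightarrow> real) (\<Omega>::'n qpn \<Rightarrow> complex) b f.
     let n = real CARD('n);
         \<omega>i = (\<lambda>i (x::'n qpn). qpn_norm p x powr \<alpha>i i);
         \<omega> = (\<lambda>x::'n qpn. qpn_norm p x powr \<alpha>);
         lam_s = (\<Sum>i=1..m. lam_i i);
         \<beta>s = (\<Sum>i=1..m. \<beta>i i) - (\<Sum>i=1..m. (n + \<alpha>i i) / ri i);
         C8 = (\<Sum>\<^sub>\<infinity> \<gamma>::int. ennreal (\<Phi> (qp_ppow \<gamma>) /
                  real p powr (real_of_int \<gamma> * (1 - \<beta>s - (n + \<alpha>) / q + lam_s)) *
                  (\<Prod>i=1..m. 2 + real p powr (real_of_int \<bar>\<gamma>\<bar> * (\<alpha>i i + n)))))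
     in ((\<forall>a\<in>Qp_carrier p. \<Phi> a \<ge> 0) \<and> C8 < \<top> \<and>
         \<Omega> \<in> borel_measurable (restrict_space (haar p) (sphp p 0)) \<and>
         (AE y in haar p. y \<in> sphp p 0 \<longrightarrow> \<Omega> y \<noteq> 0) \<and>
         Lconj_norm_S0 p q \<Omega> < \<top> \<and>
         (\<forall>i\<in>{1..m}. b i \<in> CMO_space p (ri i) (\<omega>i i)) \<and>
         (\<forall>i\<in>{1..m}. f i \<in> MK_space p (\<beta>i i) (lam_i i) (ell_i i) (qi i) (\<omega>i i)))
        \<longrightarrow> MK_norm p \<beta>s lam_s ell q \<omega> (Hcomm p \<Phi> \<Omega> m b f)
            \<le> ennreal C * C8 * Lconj_norm_S0 p q \<Omega> *
              (\<Prod>i=1..m. CMO_norm p (ri i) (\<omega>i i) (b i)) *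
              (\<Prod>i=1..m. MK_norm p (\<beta>i i) (lam_i i) (ell_i i) (qi i) (\<omega>i i) (f i))"
proof -
  interpret padic p
    using prime_ge_2_nat[OF \<open>prime p\<close>] by unfold_locales
  \<comment> \<open>The product of the constants from the commutator factors and the scaled f_i. It
    depends only on p, n and the exponents, and is finite because \<alpha>_i > -n makes the weighted
    unit ball finite.\<close>
  define K where "K = (\<Prod>i=1..m. epowr (s0 TYPE('n) * w0 TYPE('n) (\<alpha>i i)) (1 / ri i)) *
    (\<Prod>i=1..m. epowr (s0 TYPE('n)) (1 / qi i))"
  have "w0 TYPE('n) (\<alpha>i i) \<noteq> \<top>" if "i \<in> {1..m}" for i
    using assms(5) that by (intro w0_neq_top) auto
  then have "(\<Prod>i=1..m. epowr (s0 TYPE('n) * w0 TYPE('n) (\<alpha>i i)) (1 / ri i)) \<noteq> \<top>"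
    by (intro ennreal_prod_neq_top) (simp add: ennreal_mult_eq_top_iff)
  moreover have "(\<Prod>i=1..m. epowr (s0 TYPE('n)) (1 / qi i)) \<noteq> \<top>"
    by (intro ennreal_prod_neq_top) simp
  ultimately have "K \<noteq> \<top>"
    by (simp add: K_def ennreal_mult_eq_top_iff)
  then have K: "ennreal (enn2real K) = K" by (simp add: less_top)
  show ?thesis
    unfolding Let_def
  proof (intro exI[of _ "enn2real K"] allI impI, unfold K, elim conjE)
    fix \<Phi> :: "qp \<Rightarrow> real" and \<Omega> :: "'n qpn \<Rightarrow> complex" and b f
    assume \<Phi>: "\<forall>a\<in>Qp_carrier p. \<Phi> a \<ge> 0"
      and \<Omega>: "\<Omega> \<in> borel_measurable (restrict_space (haar p) (sphp p 0))"
      and b: "\<forall>i\<in>{1..m}. b i \<in> CMO_space p (ri i) (\<lambda>x::'n qpn. qpn_norm p x powr \<alpha>i i)"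
      and f: "\<forall>i\<in>{1..m}. f i \<in> MK_space p (\<beta>i i) (lam_i i) (ell_i i) (qi i) (\<lambda>x::'n qpn. qpn_norm p x powr \<alpha>i i)"
    show "MK_norm p ((\<Sum>i=1..m. \<beta>i i) - (\<Sum>i=1..m. (real CARD('n) + \<alpha>i i) / ri i)) (\<Sum>i=1..m. lam_i i) ell q
        (\<lambda>x. qpn_norm p x powr \<alpha>) (Hcomm p \<Phi> \<Omega> m b f)
      \<le> K * (\<Sum>\<^sub>\<infinity> \<gamma>::int. ennreal (\<Phi> (qp_ppow \<gamma>) / real p powr (real_of_int \<gamma> *
            (1 - ((\<Sum>i=1..m. \<beta>i i) - (\<Sum>i=1..m. (real CARD('n) + \<alpha>i i) / ri i)) - (real CARD('n) + \<alpha>) / q + (\<Sum>i=1..m. lam_i i))) *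
          (\<Prod>i=1..m. 2 + real p powr (real_of_int \<bar>\<gamma>\<bar> * (\<alpha>i i + real CARD('n)))))) * Lconj_norm_S0 p q \<Omega> *
        (\<Prod>i=1..m. CMO_norm p (ri i) (\<lambda>x. qpn_norm p x powr \<alpha>i i) (b i)) *
        (\<Prod>i=1..m. MK_norm p (\<beta>i i) (lam_i i) (ell_i i) (qi i) (\<lambda>x. qpn_norm p x powr \<alpha>i i) (f i))"
      unfolding K_def
      by (rule MK_norm_Hcomm_le) (use assms \<Phi> \<Omega> b f in \<open>auto simp: CMO_space_def MK_space_def\<close>)
  qed
qed

end
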